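(* Let $n\ge3$, let $k$ be a positive integer, let $f\in R_{2k}$ and $\alpha^*:=\min_{x\in S}f(x)$. Let $h(t)$ be an even univariate real polynomial of degree $2s$, nonnegative on $[-1,1]$, with Gegenbauer expansion $h=\sum_{j=0}^{s}\lambda_{2j}g_{2j}$ such that $\lambda_0=1$ and such that $\hat{\Gamma}_h:R_{2k}\to R_{2k}$ is invertible (equivalently $\lambda_{2j}\ne0$ for $j=0,\dots,k$). Let $(X,W)$ be a cubature rule for $\mu$ of algebraic degree $2(k+s)$. Let $f=\|x\|^{2k}f_0+\|x\|^{2(k-1)}f_2+\dots+f_{2k}$ be the harmonic decomposition of $f$, and put \[F:=\hat\Gamma_h^{-1}(f)=\|x\|^{2k}f_0+\frac1{\lambda_2}\|x\|^{2(k-1)}f_2+\frac1{\lambda_4}\|x\|^{2(k-2)}f_4+\dots+\frac1{\lambda_{2k}}f_{2k},\qquad\beta^*:=\min_{z\in X}F(z).\] Then $\beta^*\le\alpha^*$.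
   Context: $S\subseteq\mathbb{R}^n$ is the unit sphere, $\mu$ is the $(n-1)$-dimensional area measure on $S$, $R_d\subseteq\mathbb{R}[x_1,\dots,x_n]$ is the space of homogeneous polynomials of degree $d$, and $H_d\subseteq R_d$ is the subspace of harmonic ones. Every $f\in R_{2k}$ can be written uniquely as $f=\sum_{j=0}^k\|x\|^{2(k-j)}f_{2j}$ with $f_{2j}\in H_{2j}$ (harmonic decomposition). A cubature rule of algebraic degree $2t$ for $\mu$ is a pair $(X,W)$ with $X\subseteq S$ finite and $W:X\to\mathbb{R}_{>0}$ such that $\int_S f\,d\mu=\sum_{x\in X}W(x)f(x)$ for every $f\in R_{2t}$. With $\alpha=\frac{n-2}{2}$, the Gegenbauer polynomials are given by $C_0^{(\alpha)}(t)=1$, $C_1^{(\alpha)}(t)=2\alpha t$, $C_j^{(\alpha)}(t)=\frac1j[2t(j+\alpha-1)C_{j-1}^{(\alpha)}(t)-(j+2\alpha-2)C_{j-2}^{(\alpha)}(t)]$ for $j\ge2$, and the normalized ones are $g_j(t)=\frac{\dim(H_j)}{\mu(S)C_j^{(\alpha)}(1)}C_j^{(\alpha)}(t)$. For $h(t)=\sum_{j=0}^sa_{2j}t^{2j}$, $\hat{\Gamma}_h:R_{2k}\to R_{2k}$ is $\hat{\Gamma}_h(f)(x)=\sum_{j=0}^sa_{2j}\|x\|^{2(k-j)}\int_S\langle x,y\rangle^{2j}f(y)\,d\mu(y)$ (for $j>k$ this is division by $\|x\|^{2(j-k)}$, and the quotient is a polynomial). *)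

theory Defs
  imports "HOL-Analysis.Analysis" "HOL-Library.Function_Algebras"
    "HOL-Computational_Algebra.Polynomial"
begin

text \<open>
  Polynomials on real n-space are represented by the functions they induce (faithful, since the
  reals are infinite); \<^typ>\<open>real ^ 'n\<close> with a finite index type provides n = CARD('n) variables.
\<close>

global_interpretation real_fun: vector_space "\<lambda>(c::real) (f::'a \<Rightarrow> real) x. c * f x"
  defines real_fun_span = real_fun.span
    and real_fun_dim = real_fun.dim
  by unfold_locales (auto simp: fun_eq_iff algebra_simps)

definition monomial_fun :: "('n \<Rightarrow> nat) \<Rightarrow> real ^ 'n::finite \<Rightarrow> real" where
  "monomial_fun a x = (\<Prod>i\<in>UNIV. x $ i ^ a i)"

definition homogeneous :: "nat \<Rightarrow> (real ^ 'n::finite \<Rightarrow> real) set" where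
  "homogeneous d = real_fun_span {monomial_fun a | a. (\<Sum>i\<in>UNIV. a i) = d}"

definition laplacian :: "(real ^ 'n::finite \<Rightarrow> real) \<Rightarrow> real ^ 'n \<Rightarrow> real" where
  "laplacian f x = (\<Sum>i\<in>UNIV. (deriv ^^ 2) (\<lambda>t. f (x + t *\<^sub>R axis i 1)) 0)"

definition harmonic :: "nat \<Rightarrow> (real ^ 'n::finite \<Rightarrow> real) set" where
  "harmonic d = {f \<in> homogeneous d. \<forall>x. laplacian f x = 0}"

text \<open>The components are indexed by their degrees, i.e. only \<open>p (2 * j)\<close> for \<open>j \<le> k\<close> matters.\<close>

definition harmonic_decomposition ::
    "nat \<Rightarrow> (real ^ 'n::finite \<Rightarrow> real) \<Rightarrow> (nat \<Rightarrow> real ^ 'n \<Rightarrow> real) \<Rightarrow> bool" where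
  "harmonic_decomposition k f p \<longleftrightarrow>
     (\<forall>j\<le>k. p (2 * j) \<in> harmonic (2 * j)) \<and>
     (\<forall>x. f x = (\<Sum>j\<le>k. norm x ^ (2 * (k - j)) * p (2 * j) x))"

text \<open>
  The area measure on the unit sphere, given by polar coordinates: the area of a Borel set
  \<open>A\<close> of unit vectors is n times the volume of the cone of all \<open>r *\<^sub>R x\<close> with \<open>x \<in> A\<close> and
  \<open>0 < r \<le> 1\<close>. That cone is the preimage of \<open>A\<close> in the punctured unit ball under
  \<open>sgn x = x /\<^sub>R norm x\<close>.
\<close>

definition sphere_area :: "(real ^ 'n::finite) measure" where
  "sphere_area =
     scale_measure (of_nat CARD('n))
       (distr (restrict_space lborel (cball 0 1 - {0})) (restrict_space borel (sphere 0 1)) sgn)"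

text \<open>
  Only used for even \<open>d\<close>. Exactness in degree \<open>d\<close> then entails exactness in all smaller even
  degrees, since the points lie on the unit sphere.
\<close>

definition cubature_rule :: "nat \<Rightarrow> (real ^ 'n::finite) set \<Rightarrow> (real ^ 'n \<Rightarrow> real) \<Rightarrow> bool" where
  "cubature_rule d X W \<longleftrightarrow>
     finite X \<and> X \<subseteq> sphere 0 1 \<and> (\<forall>x\<in>X. W x > 0) \<and>
     (\<forall>f\<in>homogeneous d. (LINT y|sphere_area. f y) = (\<Sum>x\<in>X. W x * f x))"

fun gegenbauer :: "real \<Rightarrow> nat \<Rightarrow> real poly" where
  "gegenbauer \<alpha> 0 = 1"
| "gegenbauer \<alpha> (Suc 0) = [:0, 2 * \<alpha>:]"
| "gegenbauer \<alpha> (Suc (Suc m)) =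
     (let j = real (Suc (Suc m)) in
      smult (1 / j)
        ([:0, 2 * (j + \<alpha> - 1):] * gegenbauer \<alpha> (Suc m)
         - smult (j + 2 * \<alpha> - 2) (gegenbauer \<alpha> m)))"

definition normalized_gegenbauer :: "'n::finite itself \<Rightarrow> nat \<Rightarrow> real poly" where
  "normalized_gegenbauer _ j =
     (let C = gegenbauer ((real CARD('n) - 2) / 2) j in
      smult (real (real_fun_dim (harmonic j :: (real ^ 'n \<Rightarrow> real) set))
               / (measure (sphere_area :: (real ^ 'n) measure) (sphere 0 1) * poly C 1)) C)"

text \<open>
  The exponent of \<open>norm x\<close> is an integer and negative for \<open>j > k\<close>, where it encodes the
  division by \<open>norm x ^ (2 * (j - k))\<close>. At \<open>x = 0\<close> such summands evaluate to \<open>0\<close>, which for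
  \<open>k \<ge> 1\<close> is the value of the polynomial quotient (homogeneous of degree \<open>2 * k\<close>).
\<close>

definition Gamma_hat ::
    "real poly \<Rightarrow> nat \<Rightarrow> (real ^ 'n::finite \<Rightarrow> real) \<Rightarrow> real ^ 'n \<Rightarrow> real" where
  "Gamma_hat h k f x =
     (\<Sum>j\<le>degree h div 2. coeff h (2 * j) * norm x powi (2 * (int k - int j))
        * (LINT y|sphere_area. (x \<bullet> y) ^ (2 * j) * f y))"

end

theory Submission
  imports Defs "HOL-Probability.Distributions"
begin

text \<open>
  Writing \<open>\<lambda>\<^sub>2\<^sub>j\<close> for the coefficients of \<open>h\<close>, Funk--Hecke says that the kernel \<open>h (x \<bullet> y)\<close> acts
  on \<open>H\<^sub>2\<^sub>j\<close> as multiplication by \<open>\<lambda>\<^sub>2\<^sub>j\<close>, so \<open>Gamma_hat\<close> is diagonal in the harmonic decomposition. The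
  cubature rule turns \<open>f x = \<integral> h (x \<bullet> y) F y\<close> into a combination of the values of \<open>F\<close> on
  \<open>X\<close> with nonnegative weights, whose sum is \<open>\<lambda>\<^sub>0 = 1\<close>.

  Funk--Hecke is obtained without rotation invariance: on homogeneous polynomials of a fixed even
  degree, integration over the sphere is a positive multiple of the Gaussian integral, for which
  integration by parts exchanges multiplication by a coordinate with the partial derivative.
  Orthogonality of harmonic polynomials of different degrees and the eigenvalue property of zonal
  functions then follow by induction on the degree.
\<close>

subsection \<open>Homogeneous polynomials and their derivatives\<close>

text \<open>The proportionality of area and Gaussian integrals is a matter of scaling: for a
  homogeneous integrand, a radially decreasing weight contributes only a factor that depends on the
  weight and the degree, and both integrals reduce to the same integral over the unit ball. That
  factor changes with the degree, whereas integration by parts lowers the degree by two. Hence each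
  such computation is carried out entirely on the Gaussian side and is transferred to the sphere
  once, at its end.

  The unknown factors are never computed. The induction only shows that integration against a zonal
  polynomial is some multiple of evaluation at its pole; a trace computation determines the multiple
  afterwards, and this is where the dimension and the total area in the normalization of
  \<open>g\<close> come from. The parameter (n - 2) / 2 is the one for which the Gegenbauer
  recursion produces harmonic polynomials, and n at least 3 makes it positive, so that the values at
  1 by which one divides are positive. The cubature degree is 2k + 2s because on the sphere the
  product of kernel and \<open>F\<close> agrees with a homogeneous polynomial of that
  degree.\<close>

lemma homogeneous_induct [consumes 1, case_names zero step]:
  fixes f :: "real ^ 'n::finite \<Rightarrow> real"
  assumes "f \<in> homogeneous d"
    and "P (\<lambda>_. 0)"
    and "\<And>c a g. (\<Sum>i\<in>UNIV. a i) = d \<Longrightarrow> g \<in> homogeneous d \<Longrightarrow> P g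
           \<Longrightarrow> P (\<lambda>x. c * monomial_fun a x + g x)"
  shows "P f"
proof -
  \<comment> \<open>Membership is carried along because the step cases rely on linearity of
    derivatives and of Gaussian integrals, which is established for members only.\<close>
  have "f \<in> homogeneous d \<and> P f"
    using assms(1) unfolding homogeneous_def
  proof (induction rule: real_fun.span_induct_alt)
    case base
    then show ?case using assms(2) real_fun.span_zero by (auto simp: zero_fun_def)
  next
    case (step c g h)
    then obtain a where "g = monomial_fun a" "(\<Sum>i\<in>UNIV. a i) = d" by auto
    then have "P (\<lambda>x. c * g x + h x)" using assms(3)[of a h c] step by (simp add: homogeneous_def)
    moreover have "(\<lambda>x. c * g x) + h \<in> real_fun_span {monomial_fun a | a. (\<Sum>i\<in>UNIV. a i) = d}"
      using step by (intro real_fun.span_add real_fun.span_scale) (auto intro: real_fun.span_base)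
    ultimately show ?case by (simp add: plus_fun_def)
  qed
  then show ?thesis ..
qed

lemma homogeneous_monomial: "(\<Sum>i\<in>UNIV. a i) = d \<Longrightarrow> monomial_fun a \<in> homogeneous d"
  unfolding homogeneous_def by (rule real_fun.span_base) auto

lemma homogeneous_zero [simp]: "(\<lambda>_. 0) \<in> homogeneous d"
  using real_fun.span_zero by (auto simp: homogeneous_def zero_fun_def)

lemma homogeneous_add: "f \<in> homogeneous d \<Longrightarrow> g \<in> homogeneous d \<Longrightarrow> (\<lambda>x. f x + g x) \<in> homogeneous d"
  using real_fun.span_add unfolding homogeneous_def plus_fun_def by blast

lemma homogeneous_cmult: "f \<in> homogeneous d \<Longrightarrow> (\<lambda>x. c * f x) \<in> homogeneous d"
  using real_fun.span_scale unfolding homogeneous_def by blast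

lemma homogeneous_diff: "f \<in> homogeneous d \<Longrightarrow> g \<in> homogeneous d \<Longrightarrow> (\<lambda>x. f x - g x) \<in> homogeneous d"
  using homogeneous_add[of f d "\<lambda>x. -1 * g x"] homogeneous_cmult[of g d "-1"] by simp

lemma homogeneous_sum:
  "(\<And>i. i \<in> A \<Longrightarrow> f i \<in> homogeneous d) \<Longrightarrow> (\<lambda>x. \<Sum>i\<in>A. f i x) \<in> homogeneous d"
  by (induction A rule: infinite_finite_induct) (auto intro!: homogeneous_add)

lemma monomial_fun_mult: "monomial_fun a x * monomial_fun b x = monomial_fun (\<lambda>i. a i + b i) x"
  by (simp add: monomial_fun_def power_add prod.distrib)

lemma homogeneous_mult:
  assumes "f \<in> homogeneous d" "g \<in> homogeneous e"
  shows "(\<lambda>x. f x * g x) \<in> homogeneous (d + e)"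
  using assms(1)
proof (induction rule: homogeneous_induct)
  case zero
  then show ?case by simp
next
  case (step c a f)
  have "(\<lambda>x. monomial_fun a x * g x) \<in> homogeneous (d + e)"
    using assms(2)
  proof (induction rule: homogeneous_induct)
    case zero
    then show ?case by simp
  next
    case (step c' b g)
    have "monomial_fun (\<lambda>i. a i + b i) \<in> homogeneous (d + e)"
      using step \<open>sum a UNIV = d\<close> by (intro homogeneous_monomial) (simp add: sum.distrib)
    from homogeneous_add[OF homogeneous_cmult[OF this, of c'] step(3)]
    show ?case by (simp add: algebra_simps flip: monomial_fun_mult)
  qed
  from homogeneous_add[OF homogeneous_cmult[OF this, of c] step(3)]
  show ?case by (simp add: algebra_simps)
qed

lemma homogeneous_mult': "f \<in> homogeneous d \<Longrightarrow> g \<in> homogeneous e \<Longrightarrow> m = d + e \<Longrightarrow>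
    (\<lambda>x. f x * g x) \<in> homogeneous m"
  using homogeneous_mult by blast

lemma monomial_fun_single: "monomial_fun (\<lambda>j. if j = i then 1 else 0) x = x $ i"
  by (simp add: monomial_fun_def if_distrib[of "power _"] prod.delta cong: if_cong)

lemma homogeneous_coord: "(\<lambda>x. x $ i) \<in> homogeneous 1"
  using homogeneous_monomial[of "\<lambda>j. if j = i then 1 else 0" 1]
  by (simp add: monomial_fun_single[abs_def])

lemma homogeneous_const: "(\<lambda>_. c) \<in> homogeneous 0"
  using homogeneous_cmult[OF homogeneous_monomial[of "\<lambda>_. 0" 0], of c]
  by (simp add: monomial_fun_def[abs_def])

lemma homogeneous_power: "f \<in> homogeneous d \<Longrightarrow> (\<lambda>x. f x ^ k) \<in> homogeneous (k * d)"
proof (induction k)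
  case 0
  then show ?case using homogeneous_const[of 1] by simp
next
  case (Suc k)
  then show ?case using homogeneous_mult[of f d "\<lambda>x. f x ^ k" "k * d"] by simp
qed

lemma homogeneous_inner: "(\<lambda>x. e \<bullet> x) \<in> homogeneous 1" for e :: "real ^ 'n::finite"
  unfolding inner_vec_def inner_real_def by (intro homogeneous_sum homogeneous_cmult homogeneous_coord)

lemma norm_square_eq_sum: "(norm x)\<^sup>2 = (\<Sum>i\<in>UNIV. x $ i * x $ i)" for x :: "real ^ 'n::finite"
  by (simp add: power2_norm_eq_inner inner_vec_def)

lemma homogeneous_norm_square: "(\<lambda>x :: real ^ 'n::finite. (norm x)\<^sup>2) \<in> homogeneous 2"
  unfolding norm_square_eq_sum
  by (intro homogeneous_sum homogeneous_mult'[OF homogeneous_coord homogeneous_coord]) simp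

lemma homogeneous_norm_power: "(\<lambda>x :: real ^ 'n::finite. norm x ^ (2 * k)) \<in> homogeneous (2 * k)"
  using homogeneous_power[OF homogeneous_norm_square, of k] by (simp only: power_mult mult.commute[of k])

lemma homogeneous_scaleR: "f \<in> homogeneous d \<Longrightarrow> f (c *\<^sub>R x) = c ^ d * f x"
proof (induction rule: homogeneous_induct)
  case (step b a g)
  have "monomial_fun a (c *\<^sub>R x) = c ^ d * monomial_fun a x"
    using step(1) by (simp add: monomial_fun_def power_mult_distrib prod.distrib flip: power_sum)
  then show ?case using step by (simp add: algebra_simps)
qed auto

lemma homogeneous_continuous: "f \<in> homogeneous d \<Longrightarrow> continuous_on A f"
  by (induction rule: homogeneous_induct)
     (auto simp: monomial_fun_def intro!: continuous_intros)

lemma homogeneous_measurable [measurable_dest]: "f \<in> homogeneous d \<Longrightarrow> f \<in> borel_measurable borel"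
  by (intro borel_measurable_continuous_onI homogeneous_continuous)

section \<open>Partial derivatives, Euler's identity and the Laplacian\<close>

definition pd :: "'n \<Rightarrow> (real ^ 'n::finite \<Rightarrow> real) \<Rightarrow> real ^ 'n \<Rightarrow> real" where
  "pd i f x = deriv (\<lambda>t. f (x + t *\<^sub>R axis i 1)) 0"

lemma has_pd_monomial:
  "((\<lambda>t. monomial_fun a (x + t *\<^sub>R axis i 1)) has_real_derivative
     real (a i) * monomial_fun (a(i := a i - 1)) x) (at 0)"
proof -
  define R where "R = (\<Prod>j\<in>UNIV-{i}. x $ j ^ a j)"
  have eq: "monomial_fun a (x + t *\<^sub>R axis i 1) = (x $ i + t) ^ a i * R" for t
    unfolding monomial_fun_def R_def
    by (subst prod.remove[of _ i]) (auto simp: axis_def intro!: prod.cong)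
  have eq': "monomial_fun (a(i := a i - 1)) x = (x $ i) ^ (a i - 1) * R"
    unfolding monomial_fun_def R_def
    by (subst prod.remove[of _ i]) (auto intro!: prod.cong)
  show ?thesis unfolding eq eq' by (auto intro!: derivative_eq_intros)
qed

lemma has_pd:
  assumes "f \<in> homogeneous d"
  shows "((\<lambda>t. f (x + t *\<^sub>R axis i 1)) has_real_derivative pd i f x) (at 0)"
proof -
  have "\<exists>D. ((\<lambda>t. f (x + t *\<^sub>R axis i 1)) has_real_derivative D) (at 0)"
    using assms
  proof (induction rule: homogeneous_induct)
    case zero
    show ?case by (intro exI[of _ 0]) simp
  next
    case (step c a g)
    then obtain D where "((\<lambda>t. g (x + t *\<^sub>R axis i 1)) has_real_derivative D) (at 0)" by blast
    then show ?case using has_pd_monomial[of a x i] by (fastforce intro: derivative_eq_intros)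
  qed
  then show ?thesis unfolding pd_def using DERIV_imp_deriv by blast
qed

lemma pd_eqI: "((\<lambda>t. f (x + t *\<^sub>R axis i 1)) has_real_derivative D) (at 0) \<Longrightarrow> pd i f x = D"
  unfolding pd_def by (rule DERIV_imp_deriv)

lemma pd_monomial: "pd i (monomial_fun a) x = real (a i) * monomial_fun (a(i := a i - 1)) x"
  by (rule pd_eqI[OF has_pd_monomial])

lemma pd_const [simp]: "pd i (\<lambda>_. c) x = 0"
  by (rule pd_eqI) simp

lemma pd_add: "f \<in> homogeneous d \<Longrightarrow> g \<in> homogeneous e \<Longrightarrow> pd i (\<lambda>x. f x + g x) x = pd i f x + pd i g x"
  by (rule pd_eqI) (rule DERIV_add; rule has_pd; assumption)

lemma pd_cmult: "f \<in> homogeneous d \<Longrightarrow> pd i (\<lambda>x. c * f x) x = c * pd i f x"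
  by (rule pd_eqI) (rule DERIV_cmult; rule has_pd; assumption)

lemma pd_monomial_add:
  assumes "g \<in> homogeneous d"
  shows "pd i (\<lambda>x. c * monomial_fun a x + g x) = (\<lambda>x. c * pd i (monomial_fun a) x + pd i g x)"
  by (simp add: fun_eq_iff pd_add[OF homogeneous_cmult[OF homogeneous_monomial[OF refl]] assms]
      pd_cmult[OF homogeneous_monomial[OF refl]])

lemma pd_diff: "f \<in> homogeneous d \<Longrightarrow> g \<in> homogeneous e \<Longrightarrow> pd i (\<lambda>x. f x - g x) x = pd i f x - pd i g x"
  by (rule pd_eqI) (rule DERIV_diff; rule has_pd; assumption)

lemma pd_sum:
  "(\<And>k. k \<in> A \<Longrightarrow> f k \<in> homogeneous d) \<Longrightarrow> pd i (\<lambda>x. \<Sum>k\<in>A. f k x) x = (\<Sum>k\<in>A. pd i (f k) x)"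
  by (rule pd_eqI) (rule DERIV_sum; rule has_pd; blast)

lemma pd_mult:
  assumes "f \<in> homogeneous d" "g \<in> homogeneous e"
  shows "pd i (\<lambda>x. f x * g x) x = f x * pd i g x + pd i f x * g x"
  using DERIV_mult[OF has_pd[OF assms(1), of x i] has_pd[OF assms(2), of x i]]
  by (intro pd_eqI) (simp add: algebra_simps)

lemma pd_coord: "pd i (\<lambda>x. x $ j) x = (if i = j then 1 else 0)"
  by (rule pd_eqI) (auto simp: axis_def intro!: derivative_eq_intros)

text \<open>Truncated subtraction is harmless: for \<open>d = 0\<close> all partial derivatives
  vanish, and the zero function lies in every degree.\<close>

lemma homogeneous_pd:
  assumes "f \<in> homogeneous d"
  shows "pd i f \<in> homogeneous (d - 1)"
  using assms
proof (induction rule: homogeneous_induct)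
  case zero
  then show ?case by (simp cong: if_cong add: pd_const[abs_def])
next
  case (step c a g)
  have "pd i (monomial_fun a) \<in> homogeneous (d - 1)"
  proof (cases "a i = 0")
    case True
    then show ?thesis by (simp add: pd_monomial[abs_def])
  next
    case False
    have "(\<Sum>j\<in>UNIV. (a(i := a i - 1)) j) = d - 1"
      using step(1) False sum.remove[of UNIV i a] sum.remove[of UNIV i "a(i := a i - 1)"] by simp
    then show ?thesis unfolding pd_monomial[abs_def] by (intro homogeneous_cmult homogeneous_monomial)
  qed
  then have "(\<lambda>x. c * pd i (monomial_fun a) x + pd i g x) \<in> homogeneous (d - 1)"
    using step by (intro homogeneous_add homogeneous_cmult)
  then show ?case by (simp add: pd_monomial_add[OF step(2)])
qed

lemma pd_commute:
  assumes "f \<in> homogeneous d"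
  shows "pd i (pd j f) x = pd j (pd i f) x"
proof (cases "i = j")
  case False
  show ?thesis using assms
  proof (induction rule: homogeneous_induct)
    case zero
    then show ?case by (simp add: pd_const[abs_def])
  next
    case (step c a g)
    have mon: "pd i (pd j (monomial_fun a)) x = pd j (pd i (monomial_fun a)) x" for i j
      by (cases "i = j")
         (simp_all add: pd_monomial[abs_def] pd_cmult[OF homogeneous_monomial[OF refl]] pd_monomial
            fun_upd_twist)
    show ?case unfolding pd_monomial_add[OF step(2)]
      using step mon
      by (simp add: pd_add[OF homogeneous_cmult[OF homogeneous_pd[OF homogeneous_monomial[OF refl]]] homogeneous_pd[OF step(2)]]
          pd_cmult[OF homogeneous_pd[OF homogeneous_monomial[OF refl]]])
  qed
qed simp

lemma euler_homogeneous:
  assumes "f \<in> homogeneous d"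
  shows "(\<Sum>i\<in>UNIV. x $ i * pd i f x) = real d * f x"
  using assms
proof (induction rule: homogeneous_induct)
  case (step c a g)
  have "x $ i * pd i (monomial_fun a) x = real (a i) * monomial_fun a x" for i
  proof (cases "a i = 0")
    case True
    then show ?thesis by (simp add: pd_monomial)
  next
    case False
    define R where "R = (\<Prod>j\<in>UNIV-{i}. x $ j ^ a j)"
    have "monomial_fun (a(i := a i - 1)) x = (x $ i) ^ (a i - 1) * R"
      unfolding monomial_fun_def R_def
      by (subst prod.remove[of _ i]) (auto intro!: prod.cong)
    moreover have "monomial_fun a x = (x $ i) ^ (a i) * R"
      unfolding monomial_fun_def R_def
      by (subst prod.remove[of _ i]) (auto intro!: prod.cong)
    ultimately show ?thesis using False by (simp add: pd_monomial power_eq_if)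
  qed
  then have "(\<Sum>i\<in>UNIV. x $ i * pd i (monomial_fun a) x) = real d * monomial_fun a x"
    using step(1) by (simp flip: sum_distrib_right of_nat_sum)
  then show ?case
    using step by (simp add: pd_monomial_add[OF step(2)] distrib_left sum.distrib
        mult.left_commute[of _ c] flip: sum_distrib_left)
qed auto

lemma laplacian_eq:
  assumes "f \<in> homogeneous d"
  shows "laplacian f x = (\<Sum>i\<in>UNIV. pd i (pd i f) x)"
proof -
  \<comment> \<open>The derivative at parameter \<open>u\<close> on the line through
    \<open>x\<close> is the derivative at 0 on the line through the shifted point. This turns the
    iterated univariate derivative in \<open>laplacian\<close> into iterated
    \<open>pd\<close>.\<close>
  have "deriv (\<lambda>t. f (x + t *\<^sub>R axis i 1)) u = pd i f (x + u *\<^sub>R axis i 1)" for i u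
    using has_pd[OF assms, of "x + u *\<^sub>R axis i 1" i] DERIV_shift[of "\<lambda>t. f (x + t *\<^sub>R axis i 1)" _ 0 u]
    by (intro DERIV_imp_deriv) (simp add: algebra_simps)
  then have "deriv (\<lambda>t. f (x + t *\<^sub>R axis i 1)) = (\<lambda>u. pd i f (x + u *\<^sub>R axis i 1))" for i
    by auto
  then show ?thesis unfolding laplacian_def by (simp add: numeral_2_eq_2 pd_def)
qed

lemma homogeneous_laplacian:
  assumes "f \<in> homogeneous d"
  shows "laplacian f \<in> homogeneous (d - 2)"
proof -
  have "laplacian f = (\<lambda>x. \<Sum>i\<in>UNIV. pd i (pd i f) x)" using laplacian_eq[OF assms] by auto
  moreover have "pd i (pd i f) \<in> homogeneous (d - 2)" for i
    using homogeneous_pd[OF homogeneous_pd[OF assms], of i i] by (simp add: numeral_2_eq_2)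
  ultimately show ?thesis by (simp add: homogeneous_sum)
qed

lemma laplacian_cmult:
  assumes "f \<in> homogeneous d"
  shows "laplacian (\<lambda>x. c * f x) x = c * laplacian f x"
proof -
  have "pd i (\<lambda>x. c * f x) = (\<lambda>x. c * pd i f x)" for i using pd_cmult[OF assms] by auto
  then show ?thesis
    by (simp add: laplacian_eq[OF assms] laplacian_eq[OF homogeneous_cmult[OF assms]]
       pd_cmult[OF homogeneous_pd[OF assms]] sum_distrib_left)
qed

lemma laplacian_add:
  assumes "f \<in> homogeneous d" "g \<in> homogeneous d"
  shows "laplacian (\<lambda>x. f x + g x) x = laplacian f x + laplacian g x"
proof -
  have "pd i (\<lambda>x. f x + g x) = (\<lambda>x. pd i f x + pd i g x)" for i using pd_add[OF assms] by auto
  then show ?thesis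
    using laplacian_eq[OF homogeneous_add[OF assms]]
    by (simp add: laplacian_eq[OF assms(1)] laplacian_eq[OF assms(2)]
       pd_add[OF homogeneous_pd[OF assms(1)] homogeneous_pd[OF assms(2)]] sum.distrib)
qed

lemma laplacian_zero [simp]: "laplacian (\<lambda>_. 0) x = 0"
  by (simp add: laplacian_eq[OF homogeneous_zero] pd_const[abs_def])

lemma laplacian_sum:
  "(\<And>i. i \<in> A \<Longrightarrow> f i \<in> homogeneous d) \<Longrightarrow> laplacian (\<lambda>x. \<Sum>i\<in>A. f i x) x = (\<Sum>i\<in>A. laplacian (f i) x)"
  by (induction A rule: infinite_finite_induct)
     (simp_all add: laplacian_add[OF _ homogeneous_sum, where d = d])

lemma laplacian_diff:
  assumes "f \<in> homogeneous d" "g \<in> homogeneous d"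
  shows "laplacian (\<lambda>x. f x - g x) x = laplacian f x - laplacian g x"
  using laplacian_add[OF assms(1) homogeneous_cmult[OF assms(2), of "-1"], of x]
    laplacian_cmult[OF assms(2), of "-1" x] by simp

lemma laplacian_mult:
  assumes f: "f \<in> homogeneous d" and g: "g \<in> homogeneous e"
  shows "laplacian (\<lambda>x. f x * g x) x
     = f x * laplacian g x + 2 * (\<Sum>i\<in>UNIV. pd i f x * pd i g x) + laplacian f x * g x"
proof -
  have *: "pd i (\<lambda>x. f x * g x) = (\<lambda>x. f x * pd i g x + pd i f x * g x)" for i
    using pd_mult[OF assms] by auto
  have "pd i (pd i (\<lambda>x. f x * g x)) x = f x * pd i (pd i g) x + 2 * (pd i f x * pd i g x) + pd i (pd i f) x * g x" for i
    unfolding *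
    by (subst pd_add[OF homogeneous_mult[OF f homogeneous_pd[OF g]] homogeneous_mult[OF homogeneous_pd[OF f] g]])
       (simp add: pd_mult[OF f homogeneous_pd[OF g]] pd_mult[OF homogeneous_pd[OF f] g])
  then show ?thesis
    by (simp add: laplacian_eq[OF f] laplacian_eq[OF g] laplacian_eq[OF homogeneous_mult[OF f g]]
        sum.distrib sum_distrib_left sum_distrib_right)
qed

lemma pd_inner: "pd i (\<lambda>x. e \<bullet> x) x = e $ i"
proof -
  have "pd i (\<lambda>x. e \<bullet> x) x = (\<Sum>j\<in>UNIV. e $ j * (if i = j then 1 else 0))"
    unfolding inner_vec_def inner_real_def
    by (subst pd_sum[OF homogeneous_cmult[OF homogeneous_coord]]) (simp_all add: pd_cmult[OF homogeneous_coord] pd_coord)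
  then show ?thesis by (simp add: if_distrib cong: if_cong)
qed

lemma pd_norm_square: "pd i (\<lambda>x. (norm x)\<^sup>2) x = 2 * x $ i"
proof -
  have "pd i (\<lambda>x. (norm x)\<^sup>2) x = (\<Sum>j\<in>UNIV. pd i (\<lambda>x. x $ j * x $ j) x)"
    unfolding norm_square_eq_sum
    by (rule pd_sum[OF homogeneous_mult[OF homogeneous_coord homogeneous_coord]])
  also have "\<dots> = (\<Sum>j\<in>UNIV. if i = j then 2 * x $ j else 0)"
    by (rule sum.cong) (simp_all add: pd_mult[OF homogeneous_coord homogeneous_coord] pd_coord)
  finally show ?thesis by simp
qed

lemma laplacian_inner_mult:
  assumes "g \<in> homogeneous d"
  shows "laplacian (\<lambda>x. (e \<bullet> x) * g x) x = (e \<bullet> x) * laplacian g x + 2 * (\<Sum>i\<in>UNIV. e $ i * pd i g x)"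
proof -
  have "laplacian (\<lambda>x. e \<bullet> x) x = 0"
    by (simp add: laplacian_eq[OF homogeneous_inner] pd_inner[abs_def])
  then show ?thesis by (simp add: laplacian_mult[OF homogeneous_inner assms] pd_inner)
qed

text \<open>In the product rule, the Laplacian of the squared norm contributes 2n, and the mixed
  term contributes 4d by Euler's identity.\<close>

lemma laplacian_norm_square_mult:
  fixes g :: "real ^ 'n::finite \<Rightarrow> real"
  assumes "g \<in> homogeneous d"
  shows "laplacian (\<lambda>x. (norm x)\<^sup>2 * g x) x = (norm x)\<^sup>2 * laplacian g x + (2 * real CARD('n) + 4 * real d) * g x"
proof -
  have *: "pd i (\<lambda>x. (norm x)\<^sup>2) = (\<lambda>x. 2 * x $ i)" for i :: 'n by (auto simp: pd_norm_square)
  have "laplacian (\<lambda>x :: real ^ 'n. (norm x)\<^sup>2) x = 2 * real CARD('n)"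
    by (simp add: laplacian_eq[OF homogeneous_norm_square] * pd_cmult[OF homogeneous_coord] pd_coord)
  moreover have "(\<Sum>i\<in>UNIV. 2 * x $ i * pd i g x) = 2 * (real d * g x)"
    using euler_homogeneous[OF assms, of x] by (simp add: mult.assoc flip: sum_distrib_left)
  ultimately show ?thesis by (simp add: laplacian_mult[OF homogeneous_norm_square assms] * ring_distribs)
qed

subsection \<open>Gaussian integrals of homogeneous polynomials\<close>

text \<open>This is Fubini for a product of univariate functions. Since \<open>lborel\<close> is the
  image of a product measure indexed by \<open>Basis\<close>, the factors are first relabelled along
  the bijection from indices to axis vectors.\<close>

lemma
  fixes f :: "'n::finite \<Rightarrow> real \<Rightarrow> real"
  assumes f: "\<And>i. integrable lborel (f i)"
  shows integrable_lborel_vec_prod: "integrable lborel (\<lambda>x :: real ^ 'n. \<Prod>i\<in>UNIV. f i (x $ i))"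
    and integral_lborel_vec_prod:
      "(LINT x|lborel. (\<Prod>i\<in>UNIV. f i (x $ i))) = (\<Prod>i\<in>UNIV. LINT t|lborel. f i t)"
proof -
  interpret product_sigma_finite "\<lambda>_ :: real ^ 'n. lborel :: real measure" by unfold_locales
  let ?g = "\<lambda>b :: real ^ 'n. f (axis_index b)"
  have meas [measurable]: "f i \<in> borel_measurable borel" for i using f[of i] by auto
  have bij: "bij_betw (\<lambda>i. axis i 1 :: real ^ 'n) UNIV Basis"
    by (rule bij_betw_byWitness[where f' = axis_index]) (auto simp flip: axis_index)
  have nth: "(\<Sum>b\<in>Basis. y b *\<^sub>R b) $ i = y (axis i 1)" for y :: "real ^ 'n \<Rightarrow> real" and i
  proof -
    have "(\<Sum>b\<in>Basis. y b *\<^sub>R b) $ i = (\<Sum>b\<in>Basis. y b * (b $ i))"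
      by simp
    also have "\<dots> = (\<Sum>j\<in>UNIV. y (axis j 1) * (axis j 1 $ i))"
      using sum.reindex_bij_betw[OF bij, of "\<lambda>b. y b * (b $ i)"] by simp
    also have "\<dots> = y (axis i 1)" by (simp add: axis_def if_distrib cong: if_cong)
    finally show ?thesis .
  qed
  have eq: "(\<Prod>i\<in>UNIV. f i ((\<Sum>b\<in>Basis. y b *\<^sub>R b) $ i)) = (\<Prod>b\<in>Basis. ?g b (y b))" for y
    unfolding nth using prod.reindex_bij_betw[OF bij, of "\<lambda>b. ?g b (y b)"] by simp
  show "integrable lborel (\<lambda>x :: real ^ 'n. \<Prod>i\<in>UNIV. f i (x $ i))"
    unfolding lborel_eq[where 'a = "real ^ 'n"]
    by (subst integrable_distr_eq) (simp_all add: eq del: sum_component, intro product_integrable_prod f, simp)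
  have "(LINT x|lborel. (\<Prod>i\<in>UNIV. f i (x $ i))) = (LINT y|Pi\<^sub>M Basis (\<lambda>_. lborel). (\<Prod>b\<in>Basis. ?g b (y b)))"
    unfolding lborel_eq[where 'a = "real ^ 'n"] by (subst integral_distr) (simp_all add: eq del: sum_component)
  also have "\<dots> = (\<Prod>b\<in>Basis. LINT t|lborel. ?g b t)"
    by (intro product_integral_prod f) simp
  also have "\<dots> = (\<Prod>i\<in>UNIV. LINT t|lborel. f i t)"
    using prod.reindex_bij_betw[OF bij, of "\<lambda>b. LINT t|lborel. ?g b t"] by simp
  finally show "(LINT x|lborel. (\<Prod>i\<in>UNIV. f i (x $ i))) = (\<Prod>i\<in>UNIV. LINT t|lborel. f i t)" .
qed

definition gauss_weight :: "real ^ 'n::finite \<Rightarrow> real" where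
  "gauss_weight x = (\<Prod>i\<in>UNIV. std_normal_density (x $ i))"

definition gauss :: "(real ^ 'n::finite \<Rightarrow> real) \<Rightarrow> real" where
  "gauss f = (LINT x|lborel. gauss_weight x * f x)"

lemma gauss_weight_pos: "gauss_weight x > 0"
  unfolding gauss_weight_def by (intro prod_pos) (simp add: normal_density_pos)

lemma gauss_weight_measurable [measurable]: "gauss_weight \<in> borel_measurable borel"
  unfolding gauss_weight_def by measurable

text \<open>The defining product makes monomial integrals factor into moments; this radial form
  makes the superlevel sets balls. The Gaussian has both features at once.\<close>

lemma gauss_weight_eq:
  "gauss_weight (x :: real ^ 'n::finite) = (1 / sqrt (2 * pi)) ^ CARD('n) * exp (- (norm x)\<^sup>2 / 2)"
proof -
  have "(\<Prod>i\<in>UNIV. exp (- (x $ i)\<^sup>2 / 2)) = exp (- (norm x)\<^sup>2 / 2)"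
    unfolding norm_square_eq_sum by (simp add: power2_eq_square sum_negf flip: exp_sum sum_divide_distrib)
  then show ?thesis
    unfolding gauss_weight_def std_normal_density_def prod.distrib by simp
qed

section \<open>Gaussian moments and integration by parts\<close>

definition moment :: "nat \<Rightarrow> real" where
  "moment k = (LINT t|lborel. std_normal_density t * t ^ k)"

text \<open>Integration by parts against the standard normal density, read off the closed moment
  formulas: odd moments vanish, and consecutive even ones have the ratio
  \<open>2 * m + 1\<close>.\<close>

lemma moment_Suc: "moment (Suc k) = real k * moment (k - 1)"
proof (cases "even k")
  case True
  then obtain m where m: "k = 2 * m" by blast
  have "moment (Suc k) = 0"
    unfolding moment_def m using integral_std_normal_moment_odd[of m] by simp
  \<comment> \<open>At \<open>k = 0\<close> the truncated index gives \<open>moment 0\<close>, which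
    is not zero; there the factor \<open>real k\<close> makes the right-hand side vanish.\<close>
  moreover have "m = 0 \<or> moment (k - 1) = 0"
    unfolding moment_def m using integral_std_normal_moment_odd[of "m - 1"] by (cases m) auto
  ultimately show ?thesis by (auto simp: m)
next
  case False
  then obtain m where m: "k = Suc (2 * m)" by (auto elim: oddE)
  have "moment (Suc k) = fact (2 * Suc m) / (2 ^ Suc m * fact (Suc m))"
    unfolding moment_def m using integral_std_normal_moment_even[of "Suc m"] by simp
  moreover have "moment (k - 1) = fact (2 * m) / (2 ^ m * fact m)"
    unfolding moment_def m using integral_std_normal_moment_even[of m] by simp
  moreover have "fact (2 * Suc m) = (2 * real m + 2) * ((2 * real m + 1) * fact (2 * m))"
    "2 ^ Suc m * fact (Suc m) = (2 * real m + 2) * (2 ^ m * fact m)"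
    by (simp_all add: algebra_simps)
  ultimately show ?thesis by (simp add: m del: fact_Suc power_Suc)
qed

lemma integrable_gauss_monomial: "integrable lborel (\<lambda>x. gauss_weight x * monomial_fun a x)"
  unfolding gauss_weight_def monomial_fun_def prod.distrib[symmetric]
  by (intro integrable_lborel_vec_prod integrable_std_normal_moment)

lemma gauss_monomial: "gauss (monomial_fun a) = (\<Prod>i\<in>UNIV. moment (a i))"
  unfolding gauss_def gauss_weight_def monomial_fun_def prod.distrib[symmetric] moment_def
  by (intro integral_lborel_vec_prod integrable_std_normal_moment)

lemma integrable_gauss:
  "f \<in> homogeneous d \<Longrightarrow> integrable lborel (\<lambda>x. gauss_weight x * f x)"
proof (induction rule: homogeneous_induct)
  case (step c a g)
  then have "integrable lborel (\<lambda>x. c * (gauss_weight x * monomial_fun a x) + gauss_weight x * g x)"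
    by (intro Bochner_Integration.integrable_add integrable_mult_right integrable_gauss_monomial)
  then show ?case by (simp add: algebra_simps)
qed auto

lemma gauss_cmult [simp]: "gauss (\<lambda>x. c * f x) = c * gauss f"
  by (simp add: gauss_def mult.left_commute[of _ c])

lemma gauss_zero [simp]: "gauss (\<lambda>_. 0) = 0"
  by (simp add: gauss_def)

lemma gauss_add:
  "f \<in> homogeneous d \<Longrightarrow> g \<in> homogeneous e \<Longrightarrow> gauss (\<lambda>x. f x + g x) = gauss f + gauss g"
  unfolding gauss_def distrib_left
  by (intro Bochner_Integration.integral_add integrable_gauss)

lemma gauss_sum:
  "(\<And>i. i \<in> A \<Longrightarrow> f i \<in> homogeneous d) \<Longrightarrow> gauss (\<lambda>x. \<Sum>i\<in>A. f i x) = (\<Sum>i\<in>A. gauss (f i))"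
  by (induction A rule: infinite_finite_induct)
     (simp_all add: gauss_add[OF _ homogeneous_sum, where d = d and e = d])

text \<open>On monomials this is the recursion for the moments of the standard normal distribution.\<close>

lemma gauss_coord_mult:
  assumes "f \<in> homogeneous d"
  shows "gauss (\<lambda>x. x $ i * f x) = gauss (pd i f)"
  using assms
proof (induction rule: homogeneous_induct)
  case zero
  then show ?case by (simp add: pd_const[abs_def])
next
  case (step c a g)
  define R where "R = (\<Prod>j\<in>UNIV-{i}. moment (a j))"
  have a: "monomial_fun a \<in> homogeneous d" by (intro homogeneous_monomial step)
  have "x $ i * monomial_fun a x = monomial_fun (a(i := Suc (a i))) x" for x
  proof -
    have "(\<lambda>j. (if j = i then 1 else 0) + a j) = a(i := Suc (a i))" by auto
    then show ?thesis using monomial_fun_mult[of "\<lambda>j. if j = i then 1 else 0" x a]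
      by (simp add: monomial_fun_single)
  qed
  then have "gauss (\<lambda>x. x $ i * monomial_fun a x) = (\<Prod>j\<in>UNIV. moment ((a(i := Suc (a i))) j))"
    by (simp add: gauss_monomial flip: fun_upd_apply)
  also have "\<dots> = moment (Suc (a i)) * R"
    unfolding R_def by (subst prod.remove[of _ i]) (auto intro!: prod.cong)
  also have "moment (Suc (a i)) * R = real (a i) * (\<Prod>j\<in>UNIV. moment ((a(i := a i - 1)) j))"
    unfolding R_def by (subst (2) prod.remove[of _ i]) (auto simp: moment_Suc intro!: prod.cong)
  also have "\<dots> = gauss (pd i (monomial_fun a))"
    by (simp add: pd_monomial[abs_def] gauss_monomial flip: fun_upd_apply)
  finally have mon: "gauss (\<lambda>x. x $ i * monomial_fun a x) = gauss (pd i (monomial_fun a))" .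
  have "(\<lambda>x. x $ i * (c * monomial_fun a x + g x)) = (\<lambda>x. c * (x $ i * monomial_fun a x) + x $ i * g x)"
    by (simp add: algebra_simps)
  then show ?case
    unfolding pd_monomial_add[OF step(2)] using step mon
    by (simp add: gauss_add[OF homogeneous_cmult[OF homogeneous_pd[OF a]] homogeneous_pd]
        gauss_add[OF homogeneous_cmult[OF homogeneous_mult[OF homogeneous_coord a]]
          homogeneous_mult[OF homogeneous_coord]])
qed

text \<open>A nonnegative integrand with integral zero vanishes almost everywhere. Its zero set is
  closed by continuity, and a closed set of full measure is the whole space.\<close>

lemma gauss_nonneg_eq_0:
  assumes "f \<in> homogeneous d" "\<And>x. f x \<ge> 0" "gauss f = 0"
  shows "f x = 0"
proof -
  have "AE x in lborel. gauss_weight x * f x = 0"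
    using assms integral_nonneg_eq_0_iff_AE[OF integrable_gauss[OF assms(1)]]
    by (simp add: gauss_def gauss_weight_pos less_imp_le)
  then have "AE x in lborel. x \<in> {x. f x = 0}"
    by eventually_elim (simp add: less_imp_neq[OF gauss_weight_pos, symmetric])
  then have "AE x in lebesgue. x \<in> {x. f x = 0}"
    by (rule AE_completion)
  moreover have "closed {x. f x = 0}"
    using homogeneous_continuous[OF assms(1)] by (intro closed_Collect_eq) auto
  ultimately show ?thesis using mem_closed_if_AE_lebesgue by blast
qed

lemma gauss_square_eq_0:
  assumes "f \<in> homogeneous d" "gauss (\<lambda>x. f x * f x) = 0"
  shows "f x = 0"
  using gauss_nonneg_eq_0[OF homogeneous_mult[OF assms(1) assms(1)], of x] assms(2) by simp

subsection \<open>The area measure and Gaussian integration\<close>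

lemma nn_integral_lborel_scaleR:
  fixes f :: "'a::euclidean_space \<Rightarrow> ennreal"
  assumes [measurable]: "f \<in> borel_measurable borel" and "c > 0"
  shows "(\<integral>\<^sup>+x. f x \<partial>lborel) = ennreal (c ^ DIM('a)) * (\<integral>\<^sup>+x. f (c *\<^sub>R x) \<partial>lborel)"
  using \<open>c > 0\<close>
  by (subst lborel_affine[of c 0])
     (simp_all add: nn_integral_density nn_integral_distr nn_integral_cmult)

context
  fixes G :: "'a::euclidean_space \<Rightarrow> ennreal" and d :: nat
  assumes G_measurable [measurable]: "G \<in> borel_measurable borel"
    and G_scaleR: "\<And>c x. c > 0 \<Longrightarrow> G (c *\<^sub>R x) = ennreal (c ^ d) * G x"
begin

text \<open>The change of variables contributes \<open>DIM('a)\<close> to the exponent and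
  homogeneity contributes \<open>d\<close>. For \<open>r = 0\<close> the ball is empty and the
  exponent is positive.\<close>

lemma nn_integral_ball_scale:
  assumes "r \<ge> 0"
  shows "(\<integral>\<^sup>+x. G x * indicator (ball 0 r) x \<partial>lborel)
    = ennreal (r ^ (DIM('a) + d)) * (\<integral>\<^sup>+x. G x * indicator (ball 0 1) x \<partial>lborel)"
proof (cases "r = 0")
  case True
  then show ?thesis by (simp add: DIM_positive zero_power)
next
  case False
  with assms have r: "r > 0" by simp
  have [measurable]: "ball (0 :: 'a) r \<in> sets borel" for r by simp
  have "(\<integral>\<^sup>+x. G x * indicator (ball 0 r) x \<partial>lborel)
      = ennreal (r ^ DIM('a)) * (\<integral>\<^sup>+x. G (r *\<^sub>R x) * indicator (ball 0 r) (r *\<^sub>R x) \<partial>lborel)"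
    by (rule nn_integral_lborel_scaleR[OF _ r]) measurable
  also have "(\<integral>\<^sup>+x. G (r *\<^sub>R x) * indicator (ball 0 r) (r *\<^sub>R x) \<partial>lborel)
      = (\<integral>\<^sup>+x. ennreal (r ^ d) * (G x * indicator (ball 0 1) x) \<partial>lborel)"
    using r by (intro nn_integral_cong) (auto simp: G_scaleR indicator_def mult_less_cancel_left1)
  also have "\<dots> = ennreal (r ^ d) * (\<integral>\<^sup>+x. G x * indicator (ball 0 1) x \<partial>lborel)"
    by (rule nn_integral_cmult) measurable
  finally show ?thesis using r by (simp add: power_add ennreal_mult mult.assoc)
qed

text \<open>Layer cake: the superlevel sets of a radially decreasing weight are balls centred at the
  origin, and the integral over such a ball is reduced to the unit ball by scaling.\<close>

lemma nn_integral_radial_weight: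
  fixes w :: "'a \<Rightarrow> real" and R :: "real \<Rightarrow> real"
  assumes [measurable]: "w \<in> borel_measurable borel" "R \<in> borel_measurable borel"
    and w: "\<And>x. w x \<ge> 0" and R: "\<And>u. R u \<ge> 0"
    and levels: "\<And>u x. u > 0 \<Longrightarrow> x \<noteq> 0 \<Longrightarrow> u < w x \<longleftrightarrow> norm x < R u"
  shows "(\<integral>\<^sup>+x. G x * ennreal (w x) \<partial>lborel)
    = (\<integral>\<^sup>+u. indicator {0<..} u * ennreal (R u ^ (DIM('a) + d)) \<partial>lborel)
      * (\<integral>\<^sup>+x. G x * indicator (ball 0 1) x \<partial>lborel)"
proof -
  let ?A = "\<integral>\<^sup>+x. G x * indicator (ball 0 1) x \<partial>lborel"
  \<comment> \<open>For fixed \<open>x\<close>, integrating over \<open>u\<close> measures the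
    interval from 0 to \<open>w x\<close> and so recovers the weight.\<close>
  let ?F = "\<lambda>x (u::real). G x * (if 0 < u \<and> u < w x then 1 else 0)"
  have "(\<integral>\<^sup>+x. G x * ennreal (w x) \<partial>lborel) = (\<integral>\<^sup>+x. (\<integral>\<^sup>+u. ?F x u \<partial>lborel) \<partial>lborel)"
  proof (rule nn_integral_cong)
    fix x
    have "(\<integral>\<^sup>+u. ?F x u \<partial>lborel) = G x * (\<integral>\<^sup>+u. indicator {0<..<w x} u \<partial>lborel)"
      by (subst nn_integral_cmult[symmetric]) (auto intro!: nn_integral_cong simp: indicator_def)
    then show "G x * ennreal (w x) = (\<integral>\<^sup>+u. ?F x u \<partial>lborel)" using w[of x] by simp
  qed
  also have "\<dots> = (\<integral>\<^sup>+u. (\<integral>\<^sup>+x. ?F x u \<partial>lborel) \<partial>lborel)"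
    by (rule lborel_pair.Fubini'[symmetric]) measurable
  also have "\<dots> = (\<integral>\<^sup>+u. (indicator {0<..} u * ennreal (R u ^ (DIM('a) + d))) * ?A \<partial>lborel)"
  proof (rule nn_integral_cong)
    fix u :: real
    show "(\<integral>\<^sup>+x. ?F x u \<partial>lborel) = (indicator {0<..} u * ennreal (R u ^ (DIM('a) + d))) * ?A"
    proof (cases "u > 0")
      case True
      \<comment> \<open>The origin is a null set, and \<open>levels\<close> says nothing there: a
        weight with a pole takes an arbitrary default value at 0.\<close>
      have "AE x in lborel. x \<noteq> (0 :: 'a)" by (rule AE_lborel_singleton)
      then have "(\<integral>\<^sup>+x. ?F x u \<partial>lborel) = (\<integral>\<^sup>+x. G x * indicator (ball 0 (R u)) x \<partial>lborel)"
        by (intro nn_integral_cong_AE, eventually_elim) (use True levels in \<open>auto simp: indicator_def\<close>)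
      then show ?thesis using True nn_integral_ball_scale[OF R] by simp
    qed simp
  qed
  also have "\<dots> = (\<integral>\<^sup>+u. indicator {0<..} u * ennreal (R u ^ (DIM('a) + d)) \<partial>lborel) * ?A"
    by (rule nn_integral_multc) simp
  finally show ?thesis .
qed

end

text \<open>The order of the quantifiers is the point: \<open>K\<close> depends on the degree but
  not on \<open>G\<close>, so it cancels when two integrands of the same degree are
  compared.\<close>

lemma nn_integral_gauss_weight:
  "\<exists>K. \<forall>G \<in> (borel_measurable borel :: (real ^ 'n::finite \<Rightarrow> ennreal) set).
      (\<forall>c x. c > 0 \<longrightarrow> G (c *\<^sub>R x) = ennreal (c ^ d) * G x) \<longrightarrow>
      (\<integral>\<^sup>+x. G x * ennreal (gauss_weight x) \<partial>lborel)
        = K * (\<integral>\<^sup>+x. G x * indicator (ball 0 1) x \<partial>lborel)"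
proof -
  define C where "C = (1 / sqrt (2 * pi)) ^ CARD('n)"
  \<comment> \<open>For \<open>0 < u < C\<close> this is the solution \<open>r\<close> of
    \<open>C * exp (- r^2 / 2) = u\<close>. For \<open>u \<ge> C\<close> the superlevel set is
    empty, which radius 0 expresses.\<close>
  define R where "R u = (if 0 < u \<and> u < C then sqrt (2 * ln (C / u)) else 0)" for u
  have C: "C > 0" unfolding C_def by simp
  have gw: "gauss_weight x = C * exp (- (norm x)\<^sup>2 / 2)" for x :: "real ^ 'n"
    unfolding gauss_weight_eq C_def ..
  have R_nonneg: "R u \<ge> 0" for u
    using C by (auto simp: R_def)
  have levels: "u < gauss_weight x \<longleftrightarrow> norm x < R u" if "u > 0" for u and x :: "real ^ 'n"
  proof -
    have "u < gauss_weight x \<longleftrightarrow> u / C < exp (- (norm x)\<^sup>2 / 2)"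
      using C by (simp add: gw field_simps)
    also have "\<dots> \<longleftrightarrow> ln (u / C) < - (norm x)\<^sup>2 / 2"
      using C that by (subst ln_less_cancel_iff[symmetric]) simp_all
    also have "\<dots> \<longleftrightarrow> (norm x)\<^sup>2 < 2 * ln (C / u)"
      using C that by (simp add: ln_div) linarith
    also have "\<dots> \<longleftrightarrow> norm x < R u"
    proof (cases "u < C")
      case True
      then have "ln (C / u) \<ge> 0" using that by simp
      then have "(norm x)\<^sup>2 < 2 * ln (C / u) \<longleftrightarrow> sqrt ((norm x)\<^sup>2) < sqrt (2 * ln (C / u))"
        by (simp only: real_sqrt_less_iff)
      then show ?thesis using True that by (simp add: R_def)
    next
      case False
      then have "ln (C / u) \<le> 0" using that C by (simp add: ln_div)
      then show ?thesis using False by (auto simp: R_def not_less intro: order_trans[of _ 0])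
    qed
    finally show ?thesis .
  qed
  have [measurable]: "R \<in> borel_measurable borel" unfolding R_def by measurable
  show ?thesis
  proof (intro exI ballI impI)
    fix G :: "real ^ 'n \<Rightarrow> ennreal"
    assume [measurable]: "G \<in> borel_measurable borel"
      and G: "\<forall>c x. c > 0 \<longrightarrow> G (c *\<^sub>R x) = ennreal (c ^ d) * G x"
    show "(\<integral>\<^sup>+x. G x * ennreal (gauss_weight x) \<partial>lborel)
        = (\<integral>\<^sup>+u. indicator {0<..} u * ennreal (R u ^ (DIM(real ^ 'n) + d)) \<partial>lborel)
        * (\<integral>\<^sup>+x. G x * indicator (ball 0 1) x \<partial>lborel)"
      by (rule nn_integral_radial_weight)
         (use G in \<open>simp_all add: levels R_nonneg gauss_weight_pos less_imp_le\<close>)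
  qed
qed

text \<open>Dividing by \<open>norm x ^ d\<close> turns \<open>G\<close> into a function that is
  constant along rays, which is what the area measure integrates over the cone.\<close>

lemma nn_integral_norm_weight:
  "\<exists>K. \<forall>G \<in> (borel_measurable borel :: ('a::euclidean_space \<Rightarrow> ennreal) set).
      (\<forall>c x. c > 0 \<longrightarrow> G (c *\<^sub>R x) = ennreal (c ^ d) * G x) \<longrightarrow>
      (\<integral>\<^sup>+x. G x * ennreal (indicator (ball 0 1) x / norm x ^ d) \<partial>lborel)
        = K * (\<integral>\<^sup>+x. G x * indicator (ball 0 1) x \<partial>lborel)"
proof -
  \<comment> \<open>For \<open>d > 0\<close> the condition \<open>u < 1 / norm x ^ d\<close> bounds
    the norm by a root, capped at 1 by the ball. For \<open>d = 0\<close> the weight is the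
    indicator of the ball, with superlevel set the ball for \<open>u < 1\<close> and nothing
    otherwise.\<close>
  define R where "R u = (if u > 0 then if d = 0 then if u < 1 then 1 else 0 else min 1 (root d (1 / u)) else 0)" for u
  define w where "w x = indicator (ball 0 1) x / norm x ^ d" for x :: 'a
  have R_nonneg: "R u \<ge> 0" for u by (auto simp: R_def)
  have levels: "u < w x \<longleftrightarrow> norm x < R u" if "u > 0" "x \<noteq> 0" for u and x :: 'a
  proof (cases "norm x < 1 \<and> d > 0")
    case True
    have "norm x < root d (1 / u) \<longleftrightarrow> root d (norm x ^ d) < root d (1 / u)"
      using True by (simp add: real_root_power_cancel)
    also have "\<dots> \<longleftrightarrow> norm x ^ d < 1 / u"
      using True by simp
    also have "\<dots> \<longleftrightarrow> u < 1 / norm x ^ d"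
      using that by (simp add: less_divide_eq mult.commute)
    finally show ?thesis using True that(1) by (simp add: R_def w_def)
  next
    case False
    show ?thesis
    proof (cases "norm x < 1")
      case True
      then show ?thesis using False that(1) by (simp add: R_def w_def)
    next
      case False
      then have "\<not> norm x < R u" by (auto simp: R_def)
      then show ?thesis using False that(1) by (simp add: w_def)
    qed
  qed
  have [measurable]: "ball (0 :: 'a) 1 \<in> sets borel" by simp
  have [measurable]: "R \<in> borel_measurable borel" unfolding R_def by measurable
  have [measurable]: "w \<in> borel_measurable borel" unfolding w_def by measurable
  show ?thesis
    unfolding w_def[symmetric]
  proof (intro exI ballI impI)
    fix G :: "'a \<Rightarrow> ennreal"
    assume [measurable]: "G \<in> borel_measurable borel"
      and G: "\<forall>c x. c > 0 \<longrightarrow> G (c *\<^sub>R x) = ennreal (c ^ d) * G x"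
    have "w x \<ge> 0" for x by (simp add: w_def)
    with G show "(\<integral>\<^sup>+x. G x * ennreal (w x) \<partial>lborel)
        = (\<integral>\<^sup>+u. indicator {0<..} u * ennreal (R u ^ (DIM('a) + d)) \<partial>lborel)
        * (\<integral>\<^sup>+x. G x * indicator (ball 0 1) x \<partial>lborel)"
      by (intro nn_integral_radial_weight) (simp_all add: levels R_nonneg)
  qed
qed

section \<open>The area measure: finiteness, positivity, comparison with the Gaussian\<close>

lemma sets_sphere_area [measurable_cong]: "sets sphere_area = sets (restrict_space borel (sphere 0 1))"
  by (simp add: sphere_area_def)

lemma space_sphere_area [simp]: "space sphere_area = sphere 0 1"
  by (simp add: sphere_area_def space_scale_measure space_restrict_space)

lemma sphere_area_measurable: "f \<in> borel_measurable borel \<Longrightarrow> f \<in> borel_measurable sphere_area"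
  by (simp add: measurable_cong_sets[OF sets_sphere_area refl] measurable_restrict_space1)

lemma nn_integral_sphere_area:
  fixes f :: "real ^ 'n::finite \<Rightarrow> ennreal"
  assumes [measurable]: "f \<in> borel_measurable borel"
  shows "(\<integral>\<^sup>+x. f x \<partial>sphere_area) = of_nat CARD('n) * (\<integral>\<^sup>+x. f (sgn x) * indicator (cball 0 1 - {0}) x \<partial>lborel)"
proof -
  have [measurable]: "sgn \<in> restrict_space lborel (cball 0 1 - {0 :: real ^ 'n}) \<rightarrow>\<^sub>M restrict_space borel (sphere 0 1)"
    by (intro measurable_restrict_space2)
       (auto simp: space_restrict_space norm_sgn intro!: measurable_restrict_space1)
  have [measurable]: "f \<in> borel_measurable (restrict_space borel (sphere 0 1))"
    by (intro measurable_restrict_space1 assms)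
  show ?thesis
    unfolding sphere_area_def
    by (simp add: nn_integral_scale_measure nn_integral_distr nn_integral_restrict_space)
qed

text \<open>The sphere is the frontier of a convex set, hence null. This reconciles the closed
  punctured ball in \<open>sphere_area\<close> with the open ball of the scaling lemmas.\<close>

lemma AE_lborel_norm_neq_1: "AE x in lborel. norm (x :: 'a::euclidean_space) \<noteq> 1"
proof -
  have "sphere (0 :: 'a) 1 \<in> null_sets lborel"
    using negligible_convex_frontier[of "cball (0 :: 'a) 1"]
    by (simp add: negligible_iff_null_sets null_sets_completion_iff)
  from AE_not_in[OF this] show ?thesis by simp
qed

lemma emeasure_sphere_area:
  "emeasure sphere_area (sphere 0 1 :: (real ^ 'n::finite) set)
    = of_nat CARD('n) * emeasure lborel (ball 0 1 :: (real ^ 'n) set)"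
proof -
  have "emeasure sphere_area (sphere 0 1 :: (real ^ 'n) set) = (\<integral>\<^sup>+x. 1 \<partial>(sphere_area :: (real ^ 'n) measure))"
    by simp
  also have "\<dots> = of_nat CARD('n) * (\<integral>\<^sup>+x. 1 * indicator (cball 0 1 - {0 :: real ^ 'n}) x \<partial>lborel)"
    by (rule nn_integral_sphere_area) simp
  also have "(\<integral>\<^sup>+x. 1 * indicator (cball 0 1 - {0 :: real ^ 'n}) x \<partial>lborel)
     = (\<integral>\<^sup>+x. indicator (ball 0 1 :: (real ^ 'n) set) x \<partial>lborel)"
    using AE_lborel_norm_neq_1 AE_lborel_singleton[of "0 :: real ^ 'n"]
    by (intro nn_integral_cong_AE, eventually_elim) (simp add: indicator_def)
  also have "\<dots> = emeasure lborel (ball 0 1 :: (real ^ 'n) set)"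
    by (rule nn_integral_indicator) simp
  finally show ?thesis .
qed

interpretation sphere_area: finite_measure "sphere_area :: (real ^ 'n::finite) measure"
proof
  have "emeasure (sphere_area :: (real ^ 'n) measure) (space sphere_area) < \<infinity>"
    using emeasure_lborel_ball_finite[of "0 :: real ^ 'n" 1]
    by (simp only: space_sphere_area emeasure_sphere_area) (simp add: ennreal_mult_less_top of_nat_less_top)
  then show "emeasure (sphere_area :: (real ^ 'n) measure) (space sphere_area) \<noteq> \<infinity>" by simp
qed

lemma measure_sphere_area_pos: "measure sphere_area (sphere 0 1 :: (real ^ 'n::finite) set) > 0"
proof -
  have "emeasure lborel (ball 0 1 :: (real ^ 'n) set) > 0"
    by (simp add: emeasure_ball)
  then have "emeasure sphere_area (sphere 0 1 :: (real ^ 'n) set) > 0"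
    by (simp only: emeasure_sphere_area) (simp add: ennreal_zero_less_mult_iff)
  then show ?thesis by (simp add: sphere_area.emeasure_eq_measure)
qed

lemma integrable_sphere_area:
  fixes f :: "real ^ 'n::finite \<Rightarrow> real"
  assumes "continuous_on UNIV f"
  shows "integrable sphere_area f"
proof -
  have "compact (f ` sphere 0 1)"
    by (rule compact_continuous_image[OF continuous_on_subset[OF assms]]) simp_all
  then obtain B where B: "\<forall>y\<in>f ` sphere 0 1. norm y \<le> B"
    using bounded_iff[THEN iffD1, OF compact_imp_bounded] by blast
  show ?thesis
  proof (rule sphere_area.integrable_const_bound)
    show "AE x in sphere_area. norm (f x) \<le> B"
      using B by (intro AE_I2) simp
    show "f \<in> borel_measurable sphere_area"
      by (intro sphere_area_measurable borel_measurable_continuous_onI assms)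
  qed
qed

lemma integrable_sphere_area_homogeneous: "f \<in> homogeneous d \<Longrightarrow> integrable sphere_area f"
  by (rule integrable_sphere_area[OF homogeneous_continuous])

text \<open>Both functionals are a constant, common to all polynomials of degree \<open>d\<close>,
  times the same integral over the unit ball. The cross-multiplied form avoids dividing by a
  constant that has not yet been shown to be nonzero.\<close>

lemma gauss_sphere_area_proportional:
  fixes f g :: "real ^ 'n::finite \<Rightarrow> real"
  assumes f: "f \<in> homogeneous d" and g: "g \<in> homogeneous d"
  shows "gauss f * (LINT x|sphere_area. g x) = gauss g * (LINT x|sphere_area. f x)"
proof -
  obtain K where K: "\<And>G. G \<in> (borel_measurable borel :: (real ^ 'n \<Rightarrow> ennreal) set) \<Longrightarrow>
      (\<And>c x. c > 0 \<Longrightarrow> G (c *\<^sub>R x) = ennreal (c ^ d) * G x) \<Longrightarrow>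
      (\<integral>\<^sup>+x. G x * ennreal (gauss_weight x) \<partial>lborel) = K * (\<integral>\<^sup>+x. G x * indicator (ball 0 1) x \<partial>lborel)"
    using nn_integral_gauss_weight[of d] by blast
  obtain K' where K': "\<And>G. G \<in> (borel_measurable borel :: (real ^ 'n \<Rightarrow> ennreal) set) \<Longrightarrow>
      (\<And>c x. c > 0 \<Longrightarrow> G (c *\<^sub>R x) = ennreal (c ^ d) * G x) \<Longrightarrow>
      (\<integral>\<^sup>+x. G x * ennreal (indicator (ball 0 1) x / norm x ^ d) \<partial>lborel)
        = K' * (\<integral>\<^sup>+x. G x * indicator (ball 0 1) x \<partial>lborel)"
    using nn_integral_norm_weight[of d] by blast
  \<comment> \<open>Since \<open>ennreal\<close> sends negative numbers to 0, \<open>B f\<close>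
    sees only the positive part of \<open>f\<close>; the negative part is obtained from
    \<open>B (\<lambda>x. - f x)\<close>.\<close>
  define B where "B f = (\<integral>\<^sup>+x. ennreal (f x) * indicator (ball 0 1) x \<partial>lborel)" for f :: "real ^ 'n \<Rightarrow> real"
  have scale: "ennreal (f (c *\<^sub>R x)) = ennreal (c ^ d) * ennreal (f x)"
    if "f \<in> homogeneous d" "c > 0" for f :: "real ^ 'n \<Rightarrow> real" and c x
    using that by (simp add: homogeneous_scaleR ennreal_mult')
  have gaussB: "(\<integral>\<^sup>+x. ennreal (gauss_weight x * f x) \<partial>lborel) = K * B f"
    if f: "f \<in> homogeneous d" for f :: "real ^ 'n \<Rightarrow> real"
  proof -
    have "(\<lambda>x. ennreal (f x)) \<in> borel_measurable borel" using f by measurable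
    from K[OF this scale[OF f]] show ?thesis
      by (simp add: B_def ennreal_mult' gauss_weight_pos less_imp_le mult.commute)
  qed
  have sphereB: "(\<integral>\<^sup>+x. ennreal (f x) \<partial>sphere_area) = of_nat CARD('n) * K' * B f"
    if f: "f \<in> homogeneous d" for f :: "real ^ 'n \<Rightarrow> real"
  proof -
    have m: "(\<lambda>x. ennreal (f x)) \<in> borel_measurable borel" using f by measurable
    have cone: "ennreal (f (sgn x)) * indicator (cball 0 1 - {0}) x
        = ennreal (f x) * ennreal (indicator (ball 0 1) x / norm x ^ d)"
      if "norm x \<noteq> 1" "x \<noteq> 0" for x
    proof -
      have "ennreal (f (sgn x)) = ennreal (f x) * ennreal (1 / norm x ^ d)"
        by (simp add: sgn_div_norm homogeneous_scaleR[OF f] power_inverse divide_inverse ennreal_mult'' mult.commute)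
      then show ?thesis using that by (cases "norm x < 1") auto
    qed
    have "(\<integral>\<^sup>+x. ennreal (f (sgn x)) * indicator (cball 0 1 - {0}) x \<partial>lborel)
      = (\<integral>\<^sup>+x. ennreal (f x) * ennreal (indicator (ball 0 1) x / norm x ^ d) \<partial>lborel)"
      using AE_lborel_norm_neq_1 AE_lborel_singleton[of "0 :: real ^ 'n"]
      by (intro nn_integral_cong_AE, eventually_elim) (rule cone)
    then show ?thesis
      using K'[OF m scale[OF f]] by (simp add: nn_integral_sphere_area[OF m] B_def mult.assoc)
  qed
  have *: "gauss f = enn2real K * (enn2real (B f) - enn2real (B (\<lambda>x. - f x)))"
    "(LINT x|sphere_area. f x) = enn2real (of_nat CARD('n) * K') * (enn2real (B f) - enn2real (B (\<lambda>x. - f x)))"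
    if f: "f \<in> homogeneous d" for f :: "real ^ 'n \<Rightarrow> real"
  proof -
    have f': "(\<lambda>x. - f x) \<in> homogeneous d" using homogeneous_cmult[OF f, of "-1"] by simp
    show "gauss f = enn2real K * (enn2real (B f) - enn2real (B (\<lambda>x. - f x)))"
      using gaussB[OF f] gaussB[OF f']
      by (simp add: gauss_def real_lebesgue_integral_def[OF integrable_gauss[OF f]] enn2real_mult algebra_simps)
    show "(LINT x|sphere_area. f x) = enn2real (of_nat CARD('n) * K') * (enn2real (B f) - enn2real (B (\<lambda>x. - f x)))"
      using sphereB[OF f] sphereB[OF f']
      by (simp add: real_lebesgue_integral_def[OF integrable_sphere_area_homogeneous[OF f]] enn2real_mult algebra_simps)
  qed
  show ?thesis by (simp add: *[OF f] *[OF g])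
qed

text \<open>Only even degrees: in odd degrees both functionals vanish and the constant is not determined.\<close>

lemma sphere_area_eq_gauss:
  obtains c where "c > 0"
    "\<And>f :: real ^ 'n::finite \<Rightarrow> real. f \<in> homogeneous (2 * m) \<Longrightarrow> (LINT x|sphere_area. f x) = c * gauss f"
proof
  \<comment> \<open>This polynomial fixes the constant: it is 1 on the sphere, so its area integral
    is the total area, and it is nonnegative and not identically zero, so its Gaussian integral is
    positive.\<close>
  let ?g = "\<lambda>x :: real ^ 'n. norm x ^ (2 * m)"
  let ?\<mu> = "measure sphere_area (sphere 0 1 :: (real ^ 'n) set)"
  have "(LINT x|sphere_area. ?g x) = (LINT x|(sphere_area :: (real ^ 'n) measure). 1)"
    by (rule Bochner_Integration.integral_cong) auto
  then have g: "(LINT x|sphere_area. ?g x) = ?\<mu>" by simp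
  have "gauss ?g \<ge> 0"
    unfolding gauss_def by (intro integral_nonneg_AE) (simp add: gauss_weight_pos less_imp_le)
  moreover have "gauss ?g \<noteq> 0"
    using gauss_nonneg_eq_0[OF homogeneous_norm_power[of m], of "axis undefined 1 :: real ^ 'n"] by auto
  ultimately have pos: "gauss ?g > 0" by simp
  then show "?\<mu> / gauss ?g > 0" by (rule divide_pos_pos[OF measure_sphere_area_pos])
  fix f :: "real ^ 'n \<Rightarrow> real" assume "f \<in> homogeneous (2 * m)"
  from gauss_sphere_area_proportional[OF this homogeneous_norm_power]
  show "(LINT x|sphere_area. f x) = ?\<mu> / gauss ?g * gauss f"
    using pos unfolding g by (simp add: field_simps)
qed

subsection \<open>Harmonic polynomials and zonal functions\<close>

lemma harmonic_homogeneous: "H \<in> harmonic d \<Longrightarrow> H \<in> homogeneous d"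
  by (simp add: harmonic_def)

lemma laplacian_harmonic: "H \<in> harmonic d \<Longrightarrow> laplacian H x = 0"
  by (simp add: harmonic_def)

lemma harmonic_pd:
  assumes H: "H \<in> harmonic d"
  shows "pd i H \<in> harmonic (d - 1)"
proof -
  note h = harmonic_homogeneous[OF H]
  have "laplacian (pd i H) x = 0" for x
  proof -
    have "pd k (pd k (pd i H)) x = pd i (pd k (pd k H)) x" for k
    proof -
      have "pd k (pd i H) = pd i (pd k H)" by (rule ext) (rule pd_commute[OF h])
      then show ?thesis using pd_commute[OF homogeneous_pd[OF h], of k i k x] by (simp only:)
    qed
    then have "laplacian (pd i H) x = (\<Sum>k\<in>UNIV. pd i (pd k (pd k H)) x)"
      unfolding laplacian_eq[OF homogeneous_pd[OF h]] by (intro sum.cong refl)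
    also have "\<dots> = pd i (\<lambda>x. \<Sum>k\<in>UNIV. pd k (pd k H) x) x"
      by (rule pd_sum[symmetric]) (rule homogeneous_pd[OF homogeneous_pd[OF h]])
    also have "(\<lambda>x. \<Sum>k\<in>UNIV. pd k (pd k H) x) = (\<lambda>_. 0)"
      by (simp add: laplacian_harmonic[OF H] flip: laplacian_eq[OF h])
    finally show ?thesis by simp
  qed
  then show ?thesis using homogeneous_pd[OF h] by (simp add: harmonic_def)
qed

lemma homogeneous_0_const:
  assumes "f \<in> homogeneous 0"
  shows "f x = f y"
proof -
  \<comment> \<open>Scaling by 0 in degree 0 has the factor \<open>0 ^ 0 = 1\<close>, so every value
    equals the one at the origin.\<close>
  have "f 0 = f z" for z using homogeneous_scaleR[OF assms, of 0 z] by simp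
  from this[of x] this[of y] show ?thesis by (rule trans[OF sym])
qed

text \<open>Euler's identity writes \<open>d\<close> times \<open>H\<close> as a sum of coordinates
  times partial derivatives; integration by parts turns its integral into that of the
  Laplacian.\<close>

lemma gauss_harmonic_eq_0:
  assumes H: "H \<in> harmonic d" and "d > 0"
  shows "gauss H = 0"
proof -
  note h = harmonic_homogeneous[OF H]
  have "real d * gauss H = gauss (\<lambda>x. \<Sum>i\<in>UNIV. x $ i * pd i H x)"
    by (simp add: euler_homogeneous[OF h])
  also have "\<dots> = (\<Sum>i\<in>UNIV. gauss (\<lambda>x. x $ i * pd i H x))"
    by (rule gauss_sum[OF homogeneous_mult[OF homogeneous_coord homogeneous_pd[OF h]]])
  also have "\<dots> = (\<Sum>i\<in>UNIV. gauss (pd i (pd i H)))"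
    by (simp add: gauss_coord_mult[OF homogeneous_pd[OF h]])
  also have "\<dots> = gauss (\<lambda>x. \<Sum>i\<in>UNIV. pd i (pd i H) x)"
    by (rule gauss_sum[OF homogeneous_pd[OF homogeneous_pd[OF h]], symmetric])
  also have "\<dots> = 0" by (simp add: laplacian_harmonic[OF H] flip: laplacian_eq[OF h])
  finally show ?thesis using \<open>d > 0\<close> by simp
qed

text \<open>Euler's identity is applied to the factor \<open>P\<close>. Integration by parts then
  leaves \<open>pd i P\<close> against \<open>pd i H\<close> and \<open>pd i (pd i P)\<close>
  against \<open>H\<close>. Both pairs satisfy the degree inequality again with a smaller first
  degree, so the induction is on \<open>m\<close> with \<open>d\<close> free.\<close>

lemma gauss_harmonic_lower_degree:
  assumes "P \<in> homogeneous m" "H \<in> harmonic d" "m < d"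
  shows "gauss (\<lambda>x. P x * H x) = 0"
  using assms
proof (induction m arbitrary: P H d rule: less_induct)
  case (less m)
  note P = \<open>P \<in> homogeneous m\<close> and H = \<open>H \<in> harmonic d\<close>
  note h = harmonic_homogeneous[OF H]
  show ?case
  proof (cases "m = 0")
    case True
    then have "P x * H x = P 0 * H x" for x
      using homogeneous_0_const[of P x 0] P by (metis (no_types))
    then have "(\<lambda>x. P x * H x) = (\<lambda>x. P 0 * H x)" by (rule ext)
    then show ?thesis using gauss_harmonic_eq_0[OF H] less.prems(3) by simp
  next
    case False
    have "(\<Sum>i\<in>UNIV. x $ i * (pd i P x * H x)) = real m * (P x * H x)" for x
      by (simp only: mult.assoc[symmetric] sum_distrib_right[symmetric] euler_homogeneous[OF P])
    then have "real m * gauss (\<lambda>x. P x * H x) = gauss (\<lambda>x. \<Sum>i\<in>UNIV. x $ i * (pd i P x * H x))"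
      by simp
    also have "\<dots> = (\<Sum>i\<in>UNIV. gauss (\<lambda>x. x $ i * (pd i P x * H x)))"
      by (rule gauss_sum[OF homogeneous_mult[OF homogeneous_coord homogeneous_mult[OF homogeneous_pd[OF P] h]]])
    also have "\<dots> = 0"
    proof (rule sum.neutral, rule ballI)
      fix i
      have "gauss (\<lambda>x. x $ i * (pd i P x * H x)) = gauss (pd i (\<lambda>x. pd i P x * H x))"
        by (rule gauss_coord_mult[OF homogeneous_mult[OF homogeneous_pd[OF P] h]])
      also have "\<dots> = gauss (\<lambda>x. pd i P x * pd i H x + pd i (pd i P) x * H x)"
        by (intro arg_cong[where f = gauss] ext pd_mult[OF homogeneous_pd[OF P] h])
      also have "\<dots> = gauss (\<lambda>x. pd i P x * pd i H x) + gauss (\<lambda>x. pd i (pd i P) x * H x)"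
        by (rule gauss_add[OF homogeneous_mult[OF homogeneous_pd[OF P] homogeneous_pd[OF h]]
              homogeneous_mult[OF homogeneous_pd[OF homogeneous_pd[OF P]] h]])
      also have "gauss (\<lambda>x. pd i P x * pd i H x) = 0"
        using less.IH[OF _ homogeneous_pd[OF P] harmonic_pd[OF H]] less.prems(3) False by simp
      also have "gauss (\<lambda>x. pd i (pd i P) x * H x) = 0"
        using less.IH[OF _ homogeneous_pd[OF homogeneous_pd[OF P]] H] less.prems(3) False by simp
      finally show "gauss (\<lambda>x. x $ i * (pd i P x * H x)) = 0" by simp
    qed
    finally show ?thesis using False by simp
  qed
qed

text \<open>Multiplication by a coordinate is adjoint to differentiating the harmonic factor alone:
  the other term of the product rule has too low a degree on the side of \<open>Q\<close> and
  vanishes by orthogonality.\<close>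

lemma gauss_coord_mult_harmonic:
  assumes Q: "Q \<in> homogeneous d" and H: "H \<in> harmonic (Suc d)"
  shows "gauss (\<lambda>x. x $ i * (Q x * H x)) = gauss (\<lambda>x. Q x * pd i H x)"
proof -
  note h = harmonic_homogeneous[OF H]
  have "gauss (\<lambda>x. x $ i * (Q x * H x)) = gauss (pd i (\<lambda>x. Q x * H x))"
    by (rule gauss_coord_mult[OF homogeneous_mult[OF Q h]])
  also have "pd i (\<lambda>x. Q x * H x) = (\<lambda>x. Q x * pd i H x + pd i Q x * H x)"
    by (simp add: fun_eq_iff pd_mult[OF Q h])
  also have "gauss \<dots> = gauss (\<lambda>x. Q x * pd i H x) + gauss (\<lambda>x. pd i Q x * H x)"
    by (rule gauss_add[OF homogeneous_mult[OF Q homogeneous_pd[OF h]]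
          homogeneous_mult[OF homogeneous_pd[OF Q] h]])
  also have "gauss (\<lambda>x. pd i Q x * H x) = 0"
    by (rule gauss_harmonic_lower_degree[OF homogeneous_pd[OF Q] H]) simp
  finally show ?thesis by simp
qed

lemma gauss_inner_mult_harmonic:
  assumes Q: "Q \<in> homogeneous d" and H: "H \<in> harmonic (Suc d)"
  shows "gauss (\<lambda>x. (e \<bullet> x) * (Q x * H x)) = (\<Sum>i\<in>UNIV. e $ i * gauss (\<lambda>x. Q x * pd i H x))"
proof -
  have "gauss (\<lambda>x. (e \<bullet> x) * (Q x * H x)) = gauss (\<lambda>x. \<Sum>i\<in>UNIV. e $ i * (x $ i * (Q x * H x)))"
    by (simp add: inner_vec_def sum_distrib_right mult.assoc)
  also have "\<dots> = (\<Sum>i\<in>UNIV. gauss (\<lambda>x. e $ i * (x $ i * (Q x * H x))))"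
    by (rule gauss_sum[OF homogeneous_cmult[OF homogeneous_mult[OF homogeneous_coord
          homogeneous_mult[OF Q harmonic_homogeneous[OF H]]]]])
  finally show ?thesis by (simp add: gauss_coord_mult_harmonic[OF assms])
qed

text \<open>Applying the adjointness twice in each coordinate moves the squared norm onto
  \<open>H\<close> as its Laplacian.\<close>

lemma gauss_norm_square_mult_harmonic:
  assumes Q: "Q \<in> homogeneous d" and H: "H \<in> harmonic (Suc (Suc d))"
  shows "gauss (\<lambda>x. (norm x)\<^sup>2 * (Q x * H x)) = 0"
proof -
  note h = harmonic_homogeneous[OF H]
  have xQ: "(\<lambda>x. x $ i * Q x) \<in> homogeneous (Suc d)" for i
    using homogeneous_mult[OF homogeneous_coord Q] by simp
  have "gauss (\<lambda>x. (norm x)\<^sup>2 * (Q x * H x)) = gauss (\<lambda>x. \<Sum>i\<in>UNIV. x $ i * ((x $ i * Q x) * H x))"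
    unfolding norm_square_eq_sum by (simp add: sum_distrib_right mult.assoc)
  also have "\<dots> = (\<Sum>i\<in>UNIV. gauss (\<lambda>x. x $ i * ((x $ i * Q x) * H x)))"
    by (rule gauss_sum[OF homogeneous_mult[OF homogeneous_coord homogeneous_mult[OF xQ h]]])
  also have "\<dots> = (\<Sum>i\<in>UNIV. gauss (\<lambda>x. x $ i * (Q x * pd i H x)))"
    by (simp only: gauss_coord_mult_harmonic[OF xQ H]) (simp only: mult.assoc)
  also have "\<dots> = (\<Sum>i\<in>UNIV. gauss (\<lambda>x. Q x * pd i (pd i H) x))"
    using harmonic_pd[OF H] by (intro sum.cong refl gauss_coord_mult_harmonic[OF Q]) simp
  also have "\<dots> = gauss (\<lambda>x. \<Sum>i\<in>UNIV. Q x * pd i (pd i H) x)"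
    by (rule gauss_sum[OF homogeneous_mult[OF Q homogeneous_pd[OF homogeneous_pd[OF h]]], symmetric])
  also have "\<dots> = 0"
    by (simp add: laplacian_harmonic[OF H] flip: sum_distrib_left laplacian_eq[OF h])
  finally show ?thesis .
qed

text \<open>The homogeneous extension of \<open>\<lambda>y. C\<^sub>m (e \<bullet> y)\<close> from the sphere, for a unit vector \<open>e\<close>.\<close>

fun zonal :: "real \<Rightarrow> real ^ 'n::finite \<Rightarrow> nat \<Rightarrow> real ^ 'n \<Rightarrow> real" where
  "zonal \<alpha> e 0 = (\<lambda>y. 1)"
| "zonal \<alpha> e (Suc 0) = (\<lambda>y. 2 * \<alpha> * (e \<bullet> y))"
| "zonal \<alpha> e (Suc (Suc m)) = (\<lambda>y. 2 * (m + 1 + \<alpha>) / (m + 2) * ((e \<bullet> y) * zonal \<alpha> e (Suc m) y)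
     - (m + 2 * \<alpha>) / (m + 2) * ((norm y)\<^sup>2 * zonal \<alpha> e m y))"

lemma zonal_eq_gegenbauer:
  "norm y = 1 \<Longrightarrow> zonal \<alpha> e m y = poly (gegenbauer \<alpha> m) (e \<bullet> y)"
proof (induction \<alpha> m rule: gegenbauer.induct)
  case (3 \<alpha> m)
  define a b where "a = poly (gegenbauer \<alpha> (Suc m)) (e \<bullet> y)" and "b = poly (gegenbauer \<alpha> m) (e \<bullet> y)"
  have "zonal \<alpha> e (Suc (Suc m)) y
      = 2 * (m + 1 + \<alpha>) / (m + 2) * ((e \<bullet> y) * a) - (m + 2 * \<alpha>) / (m + 2) * b"
    using 3 by (simp add: a_def b_def add_ac)
  also have "\<dots> = poly (gegenbauer \<alpha> (Suc (Suc m))) (e \<bullet> y)"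
    by (simp add: Let_def a_def[symmetric] b_def[symmetric] divide_simps)
  finally show ?case .
qed (simp_all add: mult.commute)

lemma homogeneous_zonal: "zonal \<alpha> e m \<in> homogeneous m"
proof (induction \<alpha> e m rule: zonal.induct)
  case (1 \<alpha> e)
  then show ?case by (simp add: homogeneous_const)
next
  case (2 \<alpha> e)
  then show ?case using homogeneous_cmult[OF homogeneous_inner] by simp
next
  case (3 \<alpha> e m)
  then show ?case unfolding zonal.simps
    by (intro homogeneous_diff homogeneous_cmult homogeneous_mult'[OF homogeneous_inner]
        homogeneous_mult'[OF homogeneous_norm_square]) auto
qed

text \<open>The zonal functions are the coefficients in r of
  \<open>G = (1 - 2 r (e . y) + r^2 |y|^2)^(-\<alpha>)\<close>, and the identity says that the
  derivative of \<open>G\<close> along \<open>e\<close> is \<open>r (r d/dr + 2 \<alpha>) G\<close>.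
  It supplies the first-order term in the Laplacian of
  \<open>(e \<bullet> y) * zonal \<alpha> e m y\<close>.\<close>

lemma directional_pd_zonal:
  fixes e :: "real ^ 'n::finite"
  assumes e: "norm e = 1"
  shows "(\<Sum>i\<in>UNIV. e $ i * pd i (zonal \<alpha> e (Suc m)) y) = (m + 2 * \<alpha>) * zonal \<alpha> e m y"
proof -
  define D where "D f = (\<Sum>i\<in>UNIV. e $ i * pd i f y)" for f :: "real ^ 'n \<Rightarrow> real"
  have ee: "(\<Sum>i\<in>UNIV. e $ i * e $ i) = 1"
    using e by (simp flip: norm_square_eq_sum)
  have D_inner: "D (\<lambda>y. e \<bullet> y) = 1" by (simp add: D_def pd_inner ee)
  have D_norm: "D (\<lambda>y. (norm y)\<^sup>2) = 2 * (e \<bullet> y)"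
    by (simp add: D_def pd_norm_square inner_vec_def sum_distrib_left mult.left_commute)
  have D_mult: "D (\<lambda>x. f x * g x) = f y * D g + D f * g y"
    if "f \<in> homogeneous a" "g \<in> homogeneous b" for f g a b
    by (simp add: D_def pd_mult[OF that] distrib_left sum.distrib sum_distrib_left sum_distrib_right mult_ac)
  have D_cmult: "D (\<lambda>x. c * f x) = c * D f" if "f \<in> homogeneous a" for f c a
    by (simp add: D_def pd_cmult[OF that] sum_distrib_left mult_ac)
  have D_diff: "D (\<lambda>x. f x - g x) = D f - D g" if "f \<in> homogeneous a" "g \<in> homogeneous a" for f g a
    by (simp add: D_def pd_diff[OF that] right_diff_distrib sum_subtractf)
  have hom1: "(\<lambda>y. (e \<bullet> y) * zonal \<alpha> e (Suc m) y) \<in> homogeneous (Suc (Suc m))" for m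
    using homogeneous_mult[OF homogeneous_inner homogeneous_zonal, of e \<alpha> e "Suc m"] by simp
  have hom2: "(\<lambda>y. (norm y)\<^sup>2 * zonal \<alpha> e m y) \<in> homogeneous (Suc (Suc m))" for m
    using homogeneous_mult[OF homogeneous_norm_square homogeneous_zonal, of \<alpha> e m] by simp
  have "D (zonal \<alpha> e (Suc m)) = (m + 2 * \<alpha>) * zonal \<alpha> e m y"
  proof (induction m rule: less_induct)
    case (less m)
    show ?case
    proof (cases m)
      case 0
      then show ?thesis by (simp add: D_cmult[OF homogeneous_inner] D_inner)
    next
      case (Suc m')
      let ?t = "e \<bullet> y" and ?Z = "\<lambda>m. zonal \<alpha> e m y"
      have D1: "D (zonal \<alpha> e (Suc m')) = (m' + 2 * \<alpha>) * ?Z m'"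
        using less Suc by simp
      have "D (zonal \<alpha> e (Suc m)) = 2 * (m' + 1 + \<alpha>) / (m' + 2) * (?t * D (zonal \<alpha> e (Suc m')) + ?Z (Suc m'))
          - (m' + 2 * \<alpha>) / (m' + 2) * ((norm y)\<^sup>2 * D (zonal \<alpha> e m') + 2 * ?t * ?Z m')"
        unfolding Suc zonal.simps(3)
        by (simp only: D_diff[OF homogeneous_cmult[OF hom1] homogeneous_cmult[OF hom2]]
           D_cmult[OF hom1] D_cmult[OF hom2] D_mult[OF homogeneous_inner homogeneous_zonal]
           D_mult[OF homogeneous_norm_square homogeneous_zonal] D_inner D_norm mult_1
           of_nat_add of_nat_1 of_nat_numeral)
      also have "\<dots> = (m' + 1 + 2 * \<alpha>) * ?Z (Suc m')"
      proof (cases m')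
        case 0
        then have "D (zonal \<alpha> e m') = 0" by (simp add: D_def)
        then show ?thesis unfolding D1 using 0 by (simp add: field_simps)
      next
        case (Suc l)
        have D0: "D (zonal \<alpha> e m') = (l + 2 * \<alpha>) * ?Z l"
          using less[of l] Suc \<open>m = Suc m'\<close> by simp
        have cancel: "c * (a / c * x - b / c * y) = a * x - b * y" if "c \<noteq> 0" for a b c x y :: real
          using that by (simp add: right_diff_distrib)
        define u v where "u = ?t * ?Z m'" and "v = (norm y)\<^sup>2 * ?Z l"
        have Z: "(l + 2) * ?Z (Suc m') = 2 * (l + 1 + \<alpha>) * u - (l + 2 * \<alpha>) * v"
          unfolding Suc u_def v_def zonal.simps(3) using cancel[of "real l + 2"] by (simp add: add_ac)
        \<comment> \<open>The factor \<open>l + 3\<close> equals \<open>m' + 2\<close> and clears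
          the outer denominators. The remaining combination of \<open>u\<close> and \<open>v\<close>
          is the right-hand side of the recursion \<open>Z\<close>, so everything becomes a multiple
          of the zonal function of index \<open>Suc m'\<close>.\<close>
        have "(l + 3) * (2 * (m' + 1 + \<alpha>) / (m' + 2) * (?t * D (zonal \<alpha> e (Suc m')) + ?Z (Suc m'))
          - (m' + 2 * \<alpha>) / (m' + 2) * ((norm y)\<^sup>2 * D (zonal \<alpha> e m') + 2 * ?t * ?Z m'))
          = 2 * (l + 2 + \<alpha>) * ((l + 1 + 2 * \<alpha>) * u + ?Z (Suc m')) - (l + 1 + 2 * \<alpha>) * ((l + 2 * \<alpha>) * v + 2 * u)"
        proof -
          have c: "real (l + 3) \<noteq> 0" "real (m' + 2) = real (l + 3)" by (simp_all add: Suc)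
          show ?thesis
            unfolding D1 D0 u_def v_def c(2) cancel[OF c(1)]
            by (simp del: zonal.simps add: Suc algebra_simps)
        qed
        also have "\<dots> = 2 * (l + 2 + \<alpha>) * ?Z (Suc m') + (l + 1 + 2 * \<alpha>) * (2 * (l + 1 + \<alpha>) * u - (l + 2 * \<alpha>) * v)"
          by (simp add: algebra_simps)
        also have "\<dots> = (l + 3) * ((m' + 1 + 2 * \<alpha>) * ?Z (Suc m'))"
          unfolding Z[symmetric] Suc by (simp del: zonal.simps add: algebra_simps)
        finally show ?thesis by simp
      qed
      finally show ?thesis by (simp add: Suc)
    qed
  qed
  then show ?thesis by (simp add: D_def)
qed

text \<open>By induction only two terms survive: the derivative along \<open>e\<close> and the
  constant from the squared norm. They cancel because \<open>2n + 4l = 4 (l + 1 + \<alpha>)\<close>,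
  which is where the value of \<open>\<alpha>\<close> enters.\<close>

lemma harmonic_zonal:
  fixes e :: "real ^ 'n::finite"
  assumes e: "norm e = 1" and \<alpha>: "\<alpha> = (real CARD('n) - 2) / 2"
  shows "zonal \<alpha> e m \<in> harmonic m"
proof -
  have "laplacian (zonal \<alpha> e m) y = 0" for y
  proof (induction m rule: less_induct)
    case (less m)
    consider "m = 0" | "m = 1" | l where "m = Suc (Suc l)"
      by (metis One_nat_def not0_implies_Suc)
    then show ?case
    proof cases
      case 1
      then show ?thesis by (simp add: laplacian_eq[OF homogeneous_const] pd_const[abs_def])
    next
      case 2
      then show ?thesis
        using laplacian_inner_mult[OF homogeneous_const[of "2 * \<alpha>"], of e y]
        by (simp add: mult.commute laplacian_eq[OF homogeneous_const] pd_const[abs_def])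
    next
      case 3
      have h1: "(\<lambda>y. (e \<bullet> y) * zonal \<alpha> e (Suc l) y) \<in> homogeneous (Suc (Suc l))"
        using homogeneous_mult[OF homogeneous_inner homogeneous_zonal, of e \<alpha> e "Suc l"] by simp
      have h2: "(\<lambda>y. (norm y)\<^sup>2 * zonal \<alpha> e l y) \<in> homogeneous (Suc (Suc l))"
        using homogeneous_mult[OF homogeneous_norm_square homogeneous_zonal, of \<alpha> e l] by simp
      have n: "2 * real CARD('n) + 4 * real l = 4 * (l + 1 + \<alpha>)" by (simp add: \<alpha> field_simps)
      have "laplacian (zonal \<alpha> e m) y
         = 2 * (l + 1 + \<alpha>) / (l + 2) * (2 * ((l + 2 * \<alpha>) * zonal \<alpha> e l y))
         - (l + 2 * \<alpha>) / (l + 2) * (4 * (l + 1 + \<alpha>) * zonal \<alpha> e l y)"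
        using less[of l] less[of "Suc l"] unfolding 3 zonal.simps(3)
        by (simp only: laplacian_diff[OF homogeneous_cmult[OF h1] homogeneous_cmult[OF h2]]
           laplacian_cmult[OF h1] laplacian_cmult[OF h2] laplacian_inner_mult[OF homogeneous_zonal]
           laplacian_norm_square_mult[OF homogeneous_zonal] directional_pd_zonal[OF e] n) (simp add: add_ac)
      then show ?thesis by simp
    qed
  qed
  then show ?thesis by (simp add: harmonic_def homogeneous_zonal)
qed

text \<open>In the recursion, the summand with the squared norm integrates to zero, and the factor
  \<open>e \<bullet> y\<close> becomes the derivative of \<open>H\<close> along \<open>e\<close>.
  The induction hypothesis applies to the partial derivatives, which are harmonic of one degree
  less, and Euler's identity at \<open>e\<close> restores \<open>H e\<close>. It is essential that
  \<kappa> depends neither on \<open>e\<close> nor on \<open>H\<close>.\<close>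

lemma gauss_zonal_mult_harmonic:
  "\<exists>\<kappa>. \<forall>e :: real ^ 'n::finite. \<forall>H\<in>harmonic m. norm e = 1 \<longrightarrow> gauss (\<lambda>y. zonal \<alpha> e m y * H y) = \<kappa> * H e"
proof (induction m rule: less_induct)
  case (less m)
  have const: "gauss H = gauss (\<lambda>_ :: real ^ 'n. 1) * H e" if "H \<in> harmonic 0" for H and e :: "real ^ 'n"
  proof -
    have "H x = H e * 1" for x
      using homogeneous_0_const[OF harmonic_homogeneous[OF that], of x e] by simp
    then have "H = (\<lambda>_. H e * 1)" by (rule ext)
    then have "gauss H = gauss (\<lambda>_ :: real ^ 'n. H e * 1)" by (rule arg_cong[where f = gauss])
    also have "\<dots> = H e * gauss (\<lambda>_ :: real ^ 'n. 1)" by (rule gauss_cmult)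
    finally show ?thesis by (simp only: mult.commute)
  qed
  consider "m = 0" | "m = 1" | l where "m = Suc (Suc l)"
    by (metis One_nat_def not0_implies_Suc)
  then show ?case
  proof cases
    case 1
    then show ?thesis using const by auto
  next
    case 2
    show ?thesis
    proof (intro exI[of _ "2 * \<alpha> * gauss (\<lambda>_ :: real ^ 'n. 1)"] allI ballI impI)
      fix e :: "real ^ 'n" and H :: "real ^ 'n \<Rightarrow> real"
      assume H: "H \<in> harmonic m" and e: "norm (e :: real ^ 'n) = 1"
      have H1: "H \<in> harmonic (Suc 0)" using H 2 by simp
      have "gauss (\<lambda>y. zonal \<alpha> e m y * H y) = gauss (\<lambda>y. 2 * \<alpha> * ((e \<bullet> y) * (1 * H y)))"
        unfolding 2 One_nat_def zonal.simps(2) mult_1 mult.assoc ..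
      also have "\<dots> = 2 * \<alpha> * (\<Sum>i\<in>UNIV. e $ i * gauss (\<lambda>x. 1 * pd i H x))"
        by (simp only: gauss_cmult gauss_inner_mult_harmonic[OF homogeneous_const H1])
      also have "\<dots> = 2 * \<alpha> * (gauss (\<lambda>_ :: real ^ 'n. 1) * (\<Sum>i\<in>UNIV. e $ i * pd i H e))"
      proof -
        have "gauss (pd i H) = gauss (\<lambda>_ :: real ^ 'n. 1) * pd i H e" for i
          using harmonic_pd[OF H1] by (intro const) simp
        then show ?thesis by (simp add: sum_distrib_left mult.left_commute)
      qed
      also have "(\<Sum>i\<in>UNIV. e $ i * pd i H e) = H e"
        using euler_homogeneous[OF harmonic_homogeneous[OF H1], of e] by simp
      finally show "gauss (\<lambda>y. zonal \<alpha> e m y * H y) = 2 * \<alpha> * gauss (\<lambda>_ :: real ^ 'n. 1) * H e" by simp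
    qed
  next
    case 3
    obtain \<kappa> where \<kappa>: "\<And>(e :: real ^ 'n) H. H \<in> harmonic (Suc l) \<Longrightarrow> norm e = 1 \<Longrightarrow>
        gauss (\<lambda>y. zonal \<alpha> e (Suc l) y * H y) = \<kappa> * H e"
      using less[of "Suc l"] 3 by auto
    show ?thesis
    \<comment> \<open>The recursion contributes \<open>2 * (l + 1 + \<alpha>) / (l + 2)\<close> and
      Euler's identity in degree \<open>l + 2\<close> cancels the denominator.\<close>
    proof (intro exI[of _ "2 * (l + 1 + \<alpha>) * \<kappa>"] allI ballI impI)
      fix e :: "real ^ 'n" and H :: "real ^ 'n \<Rightarrow> real"
      assume "H \<in> harmonic m" and e: "norm (e :: real ^ 'n) = 1"
      then have H: "H \<in> harmonic (Suc (Suc l))" using 3 by simp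
      note h = harmonic_homogeneous[OF H]
      let ?a = "2 * (l + 1 + \<alpha>) / (l + 2)" and ?b = "- ((l + 2 * \<alpha>) / (l + 2))"
      have "gauss (\<lambda>y. zonal \<alpha> e m y * H y) = gauss (\<lambda>y. ?a * ((e \<bullet> y) * (zonal \<alpha> e (Suc l) y * H y))
          + ?b * ((norm y)\<^sup>2 * (zonal \<alpha> e l y * H y)))"
        unfolding 3 zonal.simps by (simp only: left_diff_distrib mult.assoc) (simp add: add_ac)
      also have "\<dots> = ?a * gauss (\<lambda>y. (e \<bullet> y) * (zonal \<alpha> e (Suc l) y * H y))
          + ?b * gauss (\<lambda>y. (norm y)\<^sup>2 * (zonal \<alpha> e l y * H y))"
        by (subst gauss_add[OF homogeneous_cmult[OF homogeneous_mult[OF homogeneous_inner homogeneous_mult[OF homogeneous_zonal h]]]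
            homogeneous_cmult[OF homogeneous_mult[OF homogeneous_norm_square homogeneous_mult[OF homogeneous_zonal h]]]])
          (simp only: gauss_cmult)
      also have "gauss (\<lambda>y. (norm y)\<^sup>2 * (zonal \<alpha> e l y * H y)) = 0"
        by (rule gauss_norm_square_mult_harmonic[OF homogeneous_zonal H])
      also have "gauss (\<lambda>y. (e \<bullet> y) * (zonal \<alpha> e (Suc l) y * H y))
          = (\<Sum>i\<in>UNIV. e $ i * gauss (\<lambda>y. zonal \<alpha> e (Suc l) y * pd i H y))"
        by (rule gauss_inner_mult_harmonic[OF homogeneous_zonal H])
      also have "\<dots> = \<kappa> * (\<Sum>i\<in>UNIV. e $ i * pd i H e)"
        using harmonic_pd[OF H] by (simp add: \<kappa>[OF _ e] sum_distrib_left mult.left_commute)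
      also have "(\<Sum>i\<in>UNIV. e $ i * pd i H e) = (l + 2) * H e"
        using euler_homogeneous[OF h, of e] by simp
      finally show "gauss (\<lambda>y. zonal \<alpha> e m y * H y) = 2 * (l + 1 + \<alpha>) * \<kappa> * H e" by simp
    qed
  qed
qed

subsection \<open>Orthonormal bases and the reproducing property of Gegenbauer kernels\<close>

definition sphere_inner :: "(real ^ 'n::finite \<Rightarrow> real) \<Rightarrow> (real ^ 'n \<Rightarrow> real) \<Rightarrow> real" where
  "sphere_inner f g = (LINT x|sphere_area. f x * g x)"

lemma integral_sphere_area_cong:
  "(\<And>x. norm x = 1 \<Longrightarrow> f x = g x) \<Longrightarrow> (LINT x|sphere_area. f x) = (LINT x|sphere_area. g x)"
  by (rule Bochner_Integration.integral_cong) simp_all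

lemma sphere_inner_cong:
  "(\<And>x. norm x = 1 \<Longrightarrow> f x = f' x) \<Longrightarrow> (\<And>x. norm x = 1 \<Longrightarrow> g x = g' x) \<Longrightarrow>
    sphere_inner f g = sphere_inner f' g'"
  unfolding sphere_inner_def by (rule integral_sphere_area_cong) simp

lemma sphere_inner_commute: "sphere_inner f g = sphere_inner g f"
  by (simp add: sphere_inner_def mult.commute)

lemma integrable_sphere_inner:
  "f \<in> homogeneous d \<Longrightarrow> g \<in> homogeneous e \<Longrightarrow> integrable sphere_area (\<lambda>x. f x * g x)"
  by (rule integrable_sphere_area_homogeneous[OF homogeneous_mult])

lemma sphere_inner_cmult: "sphere_inner (\<lambda>x. c * f x) g = c * sphere_inner f g"
  by (simp add: sphere_inner_def mult.assoc)

lemma sphere_inner_diff: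
  "f \<in> homogeneous d \<Longrightarrow> f' \<in> homogeneous d' \<Longrightarrow> g \<in> homogeneous e \<Longrightarrow>
    sphere_inner (\<lambda>x. f x - f' x) g = sphere_inner f g - sphere_inner f' g"
  unfolding sphere_inner_def left_diff_distrib
  by (rule Bochner_Integration.integral_diff; rule integrable_sphere_inner; assumption)

lemma sphere_inner_sum:
  "(\<And>i. i \<in> A \<Longrightarrow> f i \<in> homogeneous d) \<Longrightarrow> g \<in> homogeneous e \<Longrightarrow>
    sphere_inner (\<lambda>x. \<Sum>i\<in>A. f i x) g = (\<Sum>i\<in>A. sphere_inner (f i) g)"
  unfolding sphere_inner_def sum_distrib_right
  by (rule Bochner_Integration.integral_sum) (rule integrable_sphere_inner)

lemma sphere_inner_nonneg: "sphere_inner f f \<ge> 0"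
  unfolding sphere_inner_def by (rule Bochner_Integration.integral_nonneg) simp

text \<open>A square has even degree, so its area integral is a positive multiple of the Gaussian
  one, and definiteness is inherited.\<close>

lemma sphere_inner_self_eq_0:
  assumes f: "f \<in> homogeneous d" and 0: "sphere_inner f f = 0"
  shows "f = (\<lambda>_. 0)"
proof
  fix x
  have ff: "(\<lambda>x. f x * f x) \<in> homogeneous (2 * d)"
    using homogeneous_mult[OF f f] by (simp add: mult_2)
  obtain c where "c > 0" "sphere_inner f f = c * gauss (\<lambda>x. f x * f x)"
    using sphere_area_eq_gauss[of d] ff unfolding sphere_inner_def by metis
  then have "gauss (\<lambda>x. f x * f x) = 0" using 0 by simp
  then show "f x = 0" by (rule gauss_square_eq_0[OF f])
qed

lemma sphere_inner_harmonic_orthogonal: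
  assumes f: "f \<in> harmonic (2 * i)" and g: "g \<in> harmonic (2 * j)" and "i \<noteq> j"
  shows "sphere_inner f g = 0"
proof -
  have *: "sphere_inner f g = 0" if f: "f \<in> harmonic (2 * i)" and g: "g \<in> harmonic (2 * j)" and "i < j"
    for f g :: "real ^ 'n \<Rightarrow> real" and i j
  proof -
    have fg: "(\<lambda>x. f x * g x) \<in> homogeneous (2 * (i + j))"
      using homogeneous_mult[OF harmonic_homogeneous[OF f] harmonic_homogeneous[OF g]] by simp
    obtain c where "sphere_inner f g = c * gauss (\<lambda>x. f x * g x)"
      using sphere_area_eq_gauss[of "i + j"] fg unfolding sphere_inner_def by metis
    moreover have "gauss (\<lambda>x. f x * g x) = 0"
      using gauss_harmonic_lower_degree[OF harmonic_homogeneous[OF f] g] \<open>i < j\<close> by simp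
    ultimately show ?thesis by simp
  qed
  show ?thesis
  proof (cases "i < j")
    case False
    then show ?thesis using *[OF g f] \<open>i \<noteq> j\<close> by (simp add: sphere_inner_commute)
  qed (rule *[OF f g])
qed

lemma sum_fun_apply: "(\<Sum>i\<in>A. f i) x = (\<Sum>i\<in>A. f i x)"
  for f :: "'i \<Rightarrow> 'a \<Rightarrow> 'b::comm_monoid_add"
  by (induction A rule: infinite_finite_induct) auto

text \<open>Normalizing the residue is possible because the form is definite on
  \<open>homogeneous d\<close>. The cardinality is tracked since it becomes the dimension in the
  trace computation.\<close>

lemma gram_schmidt_sphere:
  fixes B :: "(real ^ 'n::finite \<Rightarrow> real) set"
  assumes "finite B" "B \<subseteq> homogeneous d" "\<not> real_fun.dependent B"
  shows "\<exists>E. finite E \<and> card E = card B \<and> E \<subseteq> homogeneous d \<and> real_fun_span E = real_fun_span B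
    \<and> (\<forall>f\<in>E. \<forall>g\<in>E. sphere_inner f g = (if f = g then 1 else 0))"
  using assms
proof (induction B rule: finite_induct)
  case empty
  then show ?case by (intro exI[of _ "{}"]) simp
next
  case (insert b B)
  have indB: "\<not> real_fun.dependent B" and b_notin: "b \<notin> real_fun_span B"
    using insert.prems insert.hyps by (simp_all add: real_fun.independent_insert)
  obtain E where E: "finite E" "card E = card B" "E \<subseteq> homogeneous d" "real_fun_span E = real_fun_span B"
    and orth: "\<And>f g. f \<in> E \<Longrightarrow> g \<in> E \<Longrightarrow> sphere_inner f g = (if f = g then 1 else 0)"
    using insert.IH insert.prems indB by auto
  have b: "b \<in> homogeneous d" using insert.prems by simp
  have hE: "e \<in> homogeneous d" if "e \<in> E" for e using E(3) that by auto
  define p where "p x = (\<Sum>e\<in>E. sphere_inner b e * e x)" for x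
  have p_eq: "p = (\<Sum>e\<in>E. (\<lambda>x. sphere_inner b e * e x))"
    by (simp add: p_def fun_eq_iff sum_fun_apply)
  have p: "p \<in> homogeneous d"
    unfolding p_def by (intro homogeneous_sum homogeneous_cmult hE)
  have p_span: "p \<in> real_fun_span E"
    unfolding p_eq by (intro real_fun.span_sum real_fun.span_scale real_fun.span_base)
  define r where "r x = b x - p x" for x
  have r_eq: "r = b - p" by (simp add: r_def fun_eq_iff)
  have r: "r \<in> homogeneous d" unfolding r_def by (intro homogeneous_diff b p)
  have rE: "sphere_inner r e = 0" if e: "e \<in> E" for e
  proof -
    have "sphere_inner p e = (\<Sum>f\<in>E. sphere_inner b f * sphere_inner f e)"
      unfolding p_def by (subst sphere_inner_sum[OF homogeneous_cmult[OF hE] hE[OF e]])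
        (simp_all add: sphere_inner_cmult)
    also have "\<dots> = (\<Sum>f\<in>E. if f = e then sphere_inner b f else 0)"
      by (intro sum.cong refl) (simp add: orth e)
    also have "\<dots> = sphere_inner b e" using e E(1) by simp
    finally show ?thesis unfolding r_def by (simp add: sphere_inner_diff[OF b p hE[OF e]])
  qed
  have "r \<noteq> (\<lambda>_. 0)"
  proof
    assume "r = (\<lambda>_. 0)"
    then have "b = p" by (simp add: r_def fun_eq_iff)
    with p_span E(4) b_notin show False by simp
  qed
  then have "sphere_inner r r \<noteq> 0" using sphere_inner_self_eq_0[OF r] by blast
  with sphere_inner_nonneg[of r] have rr: "sphere_inner r r > 0" by simp
  define s where "s = 1 / sqrt (sphere_inner r r)"
  define u where "u x = s * r x" for x
  have s: "s \<noteq> 0" "s * s * sphere_inner r r = 1" using rr by (simp_all add: s_def)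
  have u: "u \<in> homogeneous d" unfolding u_def by (intro homogeneous_cmult r)
  have uE: "sphere_inner u e = 0" if "e \<in> E" for e
    unfolding u_def by (simp add: sphere_inner_cmult rE that)
  have uu: "sphere_inner u u = 1"
  proof -
    have "sphere_inner u u = s * sphere_inner u r"
      unfolding u_def[abs_def] sphere_inner_cmult by (subst sphere_inner_commute) (simp only: sphere_inner_cmult)
    also have "sphere_inner u r = s * sphere_inner r r"
      unfolding u_def[abs_def] by (rule sphere_inner_cmult)
    finally show ?thesis using s(2) by simp
  qed
  have "u \<notin> E" using uE uu by force
  have u_span: "u \<in> real_fun_span (insert b B)"
  proof -
    have "p \<in> real_fun_span (insert b B)"
      using p_span E(4) real_fun.span_mono[of B "insert b B"] by blast
    then have "b - p \<in> real_fun_span (insert b B)"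
      by (rule real_fun.span_diff[OF real_fun.span_base[OF insertI1]])
    then show ?thesis using real_fun.span_scale unfolding u_def r_eq by blast
  qed
  have b_span: "b \<in> real_fun_span (insert u E)"
  proof -
    have "p \<in> real_fun_span (insert u E)"
      using p_span real_fun.span_mono[of E "insert u E"] by blast
    moreover have "(\<lambda>x. 1 / s * u x) \<in> real_fun_span (insert u E)"
      by (intro real_fun.span_scale real_fun.span_base) simp
    ultimately have "(\<lambda>x. 1 / s * u x) + p \<in> real_fun_span (insert u E)"
      by (intro real_fun.span_add)
    moreover have "(\<lambda>x. 1 / s * u x) + p = b"
      using s(1) by (simp add: fun_eq_iff u_def r_def)
    ultimately show ?thesis by simp
  qed
  have "real_fun_span (insert u E) = real_fun_span (insert b B)"
    unfolding real_fun.span_eq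
  proof (intro conjI insert_subsetI u_span b_span)
    show "E \<subseteq> real_fun_span (insert b B)"
      using real_fun.span_superset[of E] E(4) real_fun.span_mono[of B "insert b B"] by blast
    show "B \<subseteq> real_fun_span (insert u E)"
      using real_fun.span_superset[of B] E(4) real_fun.span_mono[of E "insert u E"] by blast
  qed
  moreover have "sphere_inner e u = 0" if "e \<in> E" for e
    using uE[OF that] by (subst sphere_inner_commute)
  then have "\<forall>f\<in>insert u E. \<forall>g\<in>insert u E. sphere_inner f g = (if f = g then 1 else 0)"
    using orth uE uu \<open>u \<notin> E\<close> by (intro ballI) (elim insertE; force)
  ultimately show ?case
    using E(1-3) \<open>u \<notin> E\<close> insert.hyps u by (intro exI[of _ "insert u E"]) simp
qed

section \<open>Finite orthonormal bases of the harmonic spaces\<close>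

lemma finite_homogeneous_basis: "finite {monomial_fun a :: real ^ 'n::finite \<Rightarrow> real | a. (\<Sum>i\<in>UNIV. a i) = d}"
proof -
  have "{a :: 'n \<Rightarrow> nat. (\<Sum>i\<in>UNIV. a i) = d} \<subseteq> UNIV \<rightarrow>\<^sub>E {..d}"
  proof
    fix a :: "'n \<Rightarrow> nat" assume "a \<in> {a. (\<Sum>i\<in>UNIV. a i) = d}"
    then have "a i \<le> d" for i using member_le_sum[of i UNIV a] by simp
    then show "a \<in> UNIV \<rightarrow>\<^sub>E {..d}" by (simp add: PiE_iff extensional_def)
  qed
  then have "finite {a :: 'n \<Rightarrow> nat. (\<Sum>i\<in>UNIV. a i) = d}"
    by (rule finite_subset) (intro finite_PiE; simp)
  then have "finite (monomial_fun ` {a :: 'n \<Rightarrow> nat. (\<Sum>i\<in>UNIV. a i) = d} :: (real ^ 'n \<Rightarrow> real) set)"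
    by (rule finite_imageI)
  then show ?thesis by (simp add: image_Collect)
qed

lemma harmonic_add: "f \<in> harmonic d \<Longrightarrow> g \<in> harmonic d \<Longrightarrow> (\<lambda>x. f x + g x) \<in> harmonic d"
  by (simp add: harmonic_def homogeneous_add laplacian_add[where d = d])

lemma harmonic_cmult: "f \<in> harmonic d \<Longrightarrow> (\<lambda>x. c * f x) \<in> harmonic d"
  by (simp add: harmonic_def homogeneous_cmult laplacian_cmult[where d = d])

lemma harmonic_zero: "(\<lambda>_. 0) \<in> harmonic d"
  by (simp add: harmonic_def)

lemma harmonic_subspace: "real_fun.subspace (harmonic d)"
  unfolding real_fun.subspace_def plus_fun_def zero_fun_def
  by (intro conjI ballI allI harmonic_zero harmonic_add harmonic_cmult)

lemma harmonic_orthonormal_basis: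
  "\<exists>E. finite E \<and> card E = real_fun_dim (harmonic d :: (real ^ 'n::finite \<Rightarrow> real) set)
    \<and> E \<subseteq> (harmonic d :: (real ^ 'n \<Rightarrow> real) set)
    \<and> (\<forall>f\<in>E. \<forall>g\<in>E. sphere_inner f g = (if f = g then 1 else 0))
    \<and> (\<forall>f\<in>harmonic d. \<forall>x. f x = (\<Sum>e\<in>E. sphere_inner f e * e x))"
proof -
  obtain B where B: "B \<subseteq> (harmonic d :: (real ^ 'n \<Rightarrow> real) set)" "\<not> real_fun.dependent B"
    "harmonic d \<subseteq> real_fun_span B" "card B = real_fun_dim (harmonic d :: (real ^ 'n \<Rightarrow> real) set)"
    using real_fun.basis_exists[of "harmonic d :: (real ^ 'n \<Rightarrow> real) set"] by blast
  have B_hom: "B \<subseteq> homogeneous d" using B(1) harmonic_homogeneous by blast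
  \<comment> \<open>An independent set inside the span of finitely many monomials is finite.\<close>
  have "finite B"
    using real_fun.independent_span_bound[OF finite_homogeneous_basis B(2)] B_hom
    unfolding homogeneous_def by blast
  then obtain E where E: "finite E" "card E = card B" "E \<subseteq> homogeneous d"
    "real_fun_span E = real_fun_span B"
    and orth: "\<And>f g. f \<in> E \<Longrightarrow> g \<in> E \<Longrightarrow> sphere_inner f g = (if f = g then 1 else 0)"
    using gram_schmidt_sphere[OF _ B_hom B(2)] by blast
  have E_harm: "E \<subseteq> harmonic d"
    using real_fun.span_superset[of E] E(4) real_fun.span_minimal[OF B(1) harmonic_subspace] by blast
  have "\<forall>f\<in>harmonic d. \<forall>x. f x = (\<Sum>e\<in>E. sphere_inner f e * e x)"
  proof (intro ballI allI)
    fix f :: "real ^ 'n \<Rightarrow> real" and x assume "f \<in> harmonic d"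
    then have "f \<in> real_fun_span E" using B(3) E(4) by blast
    then obtain c where c: "f = (\<Sum>e\<in>E. (\<lambda>x. c e * e x))"
      unfolding real_fun.span_finite[OF E(1)] by blast
    have f_eq: "f = (\<lambda>x. \<Sum>e\<in>E. c e * e x)" unfolding c by (simp add: fun_eq_iff sum_fun_apply)
    have hE: "e \<in> homogeneous d" if "e \<in> E" for e using E(3) that by auto
    have "sphere_inner f e = c e" if e: "e \<in> E" for e
    proof -
      have "sphere_inner f e = (\<Sum>g\<in>E. c g * sphere_inner g e)"
        unfolding f_eq by (subst sphere_inner_sum[OF homogeneous_cmult[OF hE] hE[OF e]])
          (simp_all add: sphere_inner_cmult)
      also have "\<dots> = (\<Sum>g\<in>E. if g = e then c g else 0)"
        by (intro sum.cong refl) (simp add: orth e)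
      also have "\<dots> = c e" using e E(1) by simp
      finally show ?thesis .
    qed
    then show "f x = (\<Sum>e\<in>E. sphere_inner f e * e x)"
      by (subst f_eq) simp
  qed
  then show ?thesis using E(1,2) B(4) E_harm orth by (intro exI[of _ E]) simp
qed

text \<open>At 1 the three-term recursion collapses to two terms, giving the rising factorial of
  \<open>2 * \<alpha>\<close> over \<open>m!\<close>. Positivity is then visible, unlike in the
  recursion with its difference.\<close>

lemma gegenbauer_at_1_Suc:
  "real (Suc m) * poly (gegenbauer \<alpha> (Suc m)) 1 = (real m + 2 * \<alpha>) * poly (gegenbauer \<alpha> m) 1"
proof (induction m)
  case (Suc m)
  define u v w where "u = poly (gegenbauer \<alpha> (Suc (Suc m))) 1" and "v = poly (gegenbauer \<alpha> (Suc m)) 1"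
    and "w = poly (gegenbauer \<alpha> m) 1"
  have "real (Suc (Suc m)) * u = 2 * (real m + 1 + \<alpha>) * v - (real m + 2 * \<alpha>) * w"
    unfolding u_def v_def w_def by (simp add: Let_def)
  moreover have "real (Suc m) * v = (real m + 2 * \<alpha>) * w"
    using Suc by (simp add: v_def w_def)
  ultimately show ?case
    unfolding u_def[symmetric] v_def[symmetric] by (simp add: algebra_simps)
qed simp

lemma gegenbauer_at_1_pos: "\<alpha> > 0 \<Longrightarrow> poly (gegenbauer \<alpha> m) 1 > 0"
proof (induction m)
  case (Suc m)
  then have "real (Suc m) * poly (gegenbauer \<alpha> (Suc m)) 1 > 0"
    unfolding gegenbauer_at_1_Suc by (intro mult_pos_pos) auto
  then show ?case by (rule zero_less_mult_pos) simp
qed simp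

text \<open>The eigenvalue of the Gegenbauer kernel is found by the trace argument: expanding
  the zonal function at \<open>x\<close> in an orthonormal basis \<open>E\<close> of \<open>harmonic d\<close> and evaluating at \<open>x\<close> gives
  \<open>C\<^sub>d(1) = \<gamma> * (\<Sum>e\<in>E. e x ^ 2)\<close>, which is then integrated over the sphere.\<close>

lemma normalized_gegenbauer_reproducing:
  fixes H :: "real ^ 'n::finite \<Rightarrow> real"
  assumes n: "CARD('n) \<ge> 3" and H: "H \<in> harmonic (2 * l)" and x: "norm x = 1"
  shows "(LINT y|sphere_area. poly (normalized_gegenbauer TYPE('n) (2 * j)) (x \<bullet> y) * H y)
    = (if j = l then H x else 0)"
proof -
  define \<alpha> where "\<alpha> = (real CARD('n) - 2) / 2"
  define C where "C = poly (gegenbauer \<alpha> (2 * j)) 1"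
  define \<mu> where "\<mu> = measure sphere_area (sphere 0 1 :: (real ^ 'n) set)"
  define N where "N = real_fun_dim (harmonic (2 * j) :: (real ^ 'n \<Rightarrow> real) set)"
  have zonal: "zonal \<alpha> e (2 * j) \<in> harmonic (2 * j)" if "norm e = 1" for e :: "real ^ 'n"
    by (rule harmonic_zonal[OF that \<alpha>_def])
  have zonal_diag: "zonal \<alpha> e (2 * j) e = C" if "norm e = 1" for e :: "real ^ 'n"
    using that by (simp add: zonal_eq_gegenbauer C_def flip: power2_norm_eq_inner)
  have "\<alpha> > 0" using n by (simp add: \<alpha>_def)
  then have C: "C > 0" unfolding C_def by (rule gegenbauer_at_1_pos)
  have \<mu>: "\<mu> > 0" unfolding \<mu>_def by (rule measure_sphere_area_pos)
  have "(LINT y|sphere_area. poly (normalized_gegenbauer TYPE('n) (2 * j)) (x \<bullet> y) * H y)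
     = (LINT y|sphere_area. real N / (\<mu> * C) * (zonal \<alpha> x (2 * j) y * H y))"
    by (rule integral_sphere_area_cong)
       (simp add: normalized_gegenbauer_def Let_def zonal_eq_gegenbauer N_def \<mu>_def C_def flip: \<alpha>_def)
  also have "\<dots> = real N / (\<mu> * C) * sphere_inner (zonal \<alpha> x (2 * j)) H"
    by (simp add: sphere_inner_def)
  finally have eq: "(LINT y|sphere_area. poly (normalized_gegenbauer TYPE('n) (2 * j)) (x \<bullet> y) * H y)
     = real N / (\<mu> * C) * sphere_inner (zonal \<alpha> x (2 * j)) H" .
  show ?thesis
  proof (cases "j = l")
    case False
    then show ?thesis
      using sphere_inner_harmonic_orthogonal[OF zonal[OF x] H False] by (simp add: eq)
  next
    case True
    \<comment> \<open>The multiple combines the area-to-Gaussian constant in degree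
      \<open>2 * (2 * j)\<close> with the Gaussian one; both are known only to exist.\<close>
    obtain \<gamma> where \<gamma>: "\<And>(e :: real ^ 'n) H. norm e = 1 \<Longrightarrow> H \<in> harmonic (2 * j) \<Longrightarrow>
        sphere_inner (zonal \<alpha> e (2 * j)) H = \<gamma> * H e"
    proof -
      obtain c where c: "\<And>f :: real ^ 'n \<Rightarrow> real. f \<in> homogeneous (2 * (2 * j)) \<Longrightarrow>
          (LINT x|sphere_area. f x) = c * gauss f"
        using sphere_area_eq_gauss by blast
      obtain \<kappa> where \<kappa>: "\<And>(e :: real ^ 'n) H. norm e = 1 \<Longrightarrow> H \<in> harmonic (2 * j) \<Longrightarrow>
          gauss (\<lambda>y. zonal \<alpha> e (2 * j) y * H y) = \<kappa> * H e"
        using gauss_zonal_mult_harmonic[of "2 * j" \<alpha>] by blast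
      have "sphere_inner (zonal \<alpha> e (2 * j)) H = c * \<kappa> * H e"
        if "norm e = 1" "H \<in> harmonic (2 * j)" for e :: "real ^ 'n" and H
      proof -
        have "(\<lambda>y. zonal \<alpha> e (2 * j) y * H y) \<in> homogeneous (2 * (2 * j))"
          by (rule homogeneous_mult'[OF homogeneous_zonal harmonic_homogeneous[OF that(2)]]) simp
        from c[OF this] \<kappa>[OF that] show ?thesis by (simp only: sphere_inner_def mult.assoc)
      qed
      then show thesis by (rule that)
    qed
    obtain E :: "(real ^ 'n \<Rightarrow> real) set" where E: "finite E" "card E = N" "E \<subseteq> harmonic (2 * j)"
      and orth: "\<forall>f\<in>E. \<forall>g\<in>E. sphere_inner f g = (if f = g then 1 else 0)"
      and expand: "\<forall>f\<in>harmonic (2 * j). \<forall>x. f x = (\<Sum>e\<in>E. sphere_inner f e * e x)"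
      using harmonic_orthonormal_basis[of "2 * j", where 'n = 'n] unfolding N_def by (elim exE conjE)
    have E_harm: "e \<in> harmonic (2 * j)" if "e \<in> E" for e using E(3) that by blast
    have C_eq: "C = (\<Sum>e\<in>E. \<gamma> * (e x * e x))" if "norm x = 1" for x
    proof -
      have "C = (\<Sum>e\<in>E. sphere_inner (zonal \<alpha> x (2 * j)) e * e x)"
        using expand[THEN bspec, OF zonal[OF that], THEN spec, of x] by (simp only: zonal_diag[OF that])
      then show ?thesis by (simp add: \<gamma>[OF that E_harm] mult.assoc)
    qed
    have "\<mu> * C = (LINT x|(sphere_area :: (real ^ 'n) measure). C)"
      by (simp add: \<mu>_def)
    also have "\<dots> = (LINT x|sphere_area. (\<Sum>e\<in>E. \<gamma> * (e x * e x)))"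
      by (rule integral_sphere_area_cong) (rule C_eq)
    also have "\<dots> = (\<Sum>e\<in>E. LINT x|sphere_area. \<gamma> * (e x * e x))"
      by (rule Bochner_Integration.integral_sum)
         (intro integrable_mult_right integrable_sphere_inner[where d = "2 * j" and e = "2 * j"]
            harmonic_homogeneous E_harm)
    also have "\<dots> = (\<Sum>e\<in>E. \<gamma> * sphere_inner e e)"
      by (simp add: sphere_inner_def)
    also have "\<dots> = real N * \<gamma>" using orth E(2) by simp
    finally have "\<mu> * C = real N * \<gamma>" .
    \<comment> \<open>Since this product equals \<open>real N * \<gamma>\<close>, neither factor is
      zero, and the normalizing constant \<open>real N / (\<mu> * C)\<close> is the inverse of
      \<open>\<gamma>\<close>.\<close>
    moreover have "\<mu> * C \<noteq> 0" using C \<mu> by simp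
    moreover have "sphere_inner (zonal \<alpha> x (2 * j)) H = \<gamma> * H x"
      using \<gamma>[OF x] H True by simp
    ultimately have "real N / (\<mu> * C) * sphere_inner (zonal \<alpha> x (2 * j)) H = H x"
      by simp
    with eq True show ?thesis by simp
  qed
qed

subsection \<open>Harmonic decomposition and the cubature bound\<close>

text \<open>Each further squared norm adds its own constant by
  \<open>laplacian_norm_square_mult\<close>. The coefficient is nonzero for \<open>l > 0\<close>, so
  the Laplacian can be inverted on such terms; at \<open>l = 0\<close> it makes up for the truncated
  exponent.\<close>

lemma laplacian_norm_power_mult_harmonic:
  fixes H :: "real ^ 'n::finite \<Rightarrow> real"
  assumes H: "H \<in> harmonic d"
  shows "laplacian (\<lambda>x. norm x ^ (2 * l) * H x) x
    = 2 * real l * (2 * real l + real CARD('n) - 2 + 2 * real d) * (norm x ^ (2 * (l - 1)) * H x)"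
proof (induction l)
  case 0
  then show ?case by (simp add: laplacian_harmonic[OF H])
next
  case (Suc l)
  have hom: "(\<lambda>x. norm x ^ (2 * l) * H x) \<in> homogeneous (2 * l + d)"
    by (rule homogeneous_mult[OF homogeneous_norm_power harmonic_homogeneous[OF H]])
  have "(\<lambda>x. norm x ^ (2 * Suc l) * H x) = (\<lambda>x. (norm x)\<^sup>2 * (norm x ^ (2 * l) * H x))"
    by (simp add: power2_eq_square mult.assoc)
  then have "laplacian (\<lambda>x. norm x ^ (2 * Suc l) * H x) x
     = (norm x)\<^sup>2 * laplacian (\<lambda>x. norm x ^ (2 * l) * H x) x
       + (2 * real CARD('n) + 4 * real (2 * l + d)) * (norm x ^ (2 * l) * H x)"
    using laplacian_norm_square_mult[OF hom] by simp
  also have "(norm x)\<^sup>2 * laplacian (\<lambda>x. norm x ^ (2 * l) * H x) x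
    = 2 * real l * (2 * real l + real CARD('n) - 2 + 2 * real d) * (norm x ^ (2 * l) * H x)"
    unfolding Suc by (cases l) (simp_all add: power2_eq_square mult_ac)
  finally show ?case by (simp add: algebra_simps)
qed

lemma harmonic_const: "(\<lambda>_. c) \<in> harmonic 0"
  by (simp add: harmonic_def homogeneous_const laplacian_eq[OF homogeneous_const] pd_const[abs_def])

text \<open>The Laplacian of \<open>f\<close> is decomposed by induction and lifted term by term to
  some \<open>q\<close> with the same Laplacian as \<open>f\<close>. The harmonic difference of
  \<open>f\<close> and \<open>q\<close> is the new top component.\<close>

lemma harmonic_decomposition_exists:
  fixes f :: "real ^ 'n::finite \<Rightarrow> real"
  assumes "f \<in> homogeneous (2 * k)"
  shows "\<exists>p. harmonic_decomposition k f p"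
  using assms
proof (induction k arbitrary: f)
  case 0
  have "f x = f 0" for x using homogeneous_0_const[of f x 0] 0 by simp
  then have "f = (\<lambda>_. f 0)" by (rule ext)
  with harmonic_const[of "f 0"] have "f \<in> harmonic 0" by metis
  then show ?case by (intro exI[of _ "\<lambda>_. f"]) (simp add: harmonic_decomposition_def)
next
  case (Suc k)
  have "laplacian f \<in> homogeneous (2 * k)" using homogeneous_laplacian[OF Suc.prems] by simp
  from Suc.IH[OF this] obtain p where p: "harmonic_decomposition k (laplacian f) p" by blast
  have p_harm: "p (2 * j) \<in> harmonic (2 * j)" if "j \<le> k" for j
    using p that by (simp add: harmonic_decomposition_def)
  \<comment> \<open>The factor in \<open>laplacian_norm_power_mult_harmonic\<close> with
    \<open>l = Suc k - j\<close> and \<open>d = 2 * j\<close>.\<close>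
  define c where "c j = 2 * real (Suc k - j) * (2 * real (Suc k - j) + real CARD('n) - 2 + 2 * real (2 * j))" for j
  have c: "c j \<noteq> 0" if "j \<le> k" for j
  proof -
    have "real CARD('n) > 0" "real (Suc k - j) \<ge> 1" "real (2 * j) \<ge> 0"
      using that by (simp_all add: zero_less_card_finite)
    then have "2 * real (Suc k - j) + real CARD('n) - 2 + 2 * real (2 * j) > 0" by linarith
    then show ?thesis using that by (simp add: c_def)
  qed
  let ?t = "\<lambda>j x. norm x ^ (2 * (Suc k - j)) * p (2 * j) x"
  have t: "?t j \<in> homogeneous (2 * Suc k)" if "j \<le> k" for j
    using that by (intro homogeneous_mult'[OF homogeneous_norm_power harmonic_homogeneous[OF p_harm]]) simp_all
  define q where "q x = (\<Sum>j\<le>k. 1 / c j * ?t j x)" for x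
  have q: "q \<in> homogeneous (2 * Suc k)"
    unfolding q_def by (intro homogeneous_sum homogeneous_cmult t) simp
  have "laplacian q x = laplacian f x" for x
  proof -
    have "laplacian q x = (\<Sum>j\<le>k. laplacian (\<lambda>x. 1 / c j * ?t j x) x)"
      unfolding q_def by (rule laplacian_sum[OF homogeneous_cmult[OF t]]) simp
    also have "\<dots> = (\<Sum>j\<le>k. norm x ^ (2 * (k - j)) * p (2 * j) x)"
    proof (rule sum.cong[OF refl])
      fix j assume "j \<in> {..k}"
      then have j: "j \<le> k" by simp
      have "laplacian (\<lambda>x. 1 / c j * ?t j x) x = 1 / c j * (c j * (norm x ^ (2 * (k - j)) * p (2 * j) x))"
        unfolding laplacian_cmult[OF t[OF j]] laplacian_norm_power_mult_harmonic[OF p_harm[OF j]] c_def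
        by simp
      then show "laplacian (\<lambda>x. 1 / c j * ?t j x) x = norm x ^ (2 * (k - j)) * p (2 * j) x"
        using c[OF j] by simp
    qed
    finally show ?thesis using p by (simp add: harmonic_decomposition_def)
  qed
  then have "(\<lambda>x. f x - q x) \<in> harmonic (2 * Suc k)"
    using homogeneous_diff[OF Suc.prems q] laplacian_diff[OF Suc.prems q] by (simp add: harmonic_def)
  moreover have "(\<lambda>x. p (2 * j) x / c j) \<in> harmonic (2 * j)" if "j \<le> k" for j
    using harmonic_cmult[OF p_harm[OF that], of "1 / c j"] by simp
  ultimately have "harmonic_decomposition (Suc k) f
     (\<lambda>m. if m = 2 * Suc k then (\<lambda>x. f x - q x) else (\<lambda>x. 1 / c (m div 2) * p m x))"
    unfolding harmonic_decomposition_def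
    by (auto simp: le_Suc_eq q_def)
  then show ?case by blast
qed

lemma homogeneous_harmonic_sum:
  assumes "\<And>j. j \<le> k \<Longrightarrow> p (2 * j) \<in> harmonic (2 * j)"
  shows "(\<lambda>x. \<Sum>j\<le>k. c j * (norm x ^ (2 * (k - j)) * p (2 * j) x)) \<in> homogeneous (2 * k)"
  by (intro homogeneous_sum homogeneous_cmult
      homogeneous_mult'[OF homogeneous_norm_power harmonic_homogeneous[OF assms]]) simp_all

text \<open>On the sphere the powers of the norm are 1, so pairing the sum with one component leaves
  only the square norm of that component.\<close>

lemma harmonic_decomposition_unique:
  fixes q :: "nat \<Rightarrow> real ^ 'n::finite \<Rightarrow> real"
  assumes q: "\<And>j. j \<le> k \<Longrightarrow> q (2 * j) \<in> harmonic (2 * j)"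
    and 0: "\<And>x. (\<Sum>j\<le>k. norm x ^ (2 * (k - j)) * q (2 * j) x) = 0" and i: "i \<le> k"
  shows "q (2 * i) x = 0"
proof -
  note qh = harmonic_homogeneous[OF q]
  have "0 = sphere_inner (\<lambda>x. \<Sum>j\<le>k. norm x ^ (2 * (k - j)) * q (2 * j) x) (q (2 * i))"
    by (simp add: 0 sphere_inner_def)
  also have "\<dots> = (\<Sum>j\<le>k. sphere_inner (\<lambda>x. norm x ^ (2 * (k - j)) * q (2 * j) x) (q (2 * i)))"
  proof (rule sphere_inner_sum[OF _ qh[OF i]])
    fix j assume "j \<in> {..k}"
    then show "(\<lambda>x. norm x ^ (2 * (k - j)) * q (2 * j) x) \<in> homogeneous (2 * k)"
      by (intro homogeneous_mult'[OF homogeneous_norm_power qh]) auto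
  qed
  also have "\<dots> = (\<Sum>j\<le>k. if j = i then sphere_inner (q (2 * i)) (q (2 * i)) else 0)"
  proof (rule sum.cong[OF refl])
    fix j assume "j \<in> {..k}"
    have "sphere_inner (\<lambda>x. norm x ^ (2 * (k - j)) * q (2 * j) x) (q (2 * i))
        = sphere_inner (q (2 * j)) (q (2 * i))"
      by (rule sphere_inner_cong) simp_all
    then show "sphere_inner (\<lambda>x. norm x ^ (2 * (k - j)) * q (2 * j) x) (q (2 * i))
        = (if j = i then sphere_inner (q (2 * i)) (q (2 * i)) else 0)"
      using sphere_inner_harmonic_orthogonal[OF q q[OF i], of j] \<open>j \<in> {..k}\<close> by simp
  qed
  also have "\<dots> = sphere_inner (q (2 * i)) (q (2 * i))" using i by simp
  finally have "q (2 * i) = (\<lambda>_. 0)" using sphere_inner_self_eq_0[OF qh[OF i]] by simp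
  then show ?thesis by simp
qed

section \<open>\<open>Gamma_hat\<close> as integration against the kernel \<open>h\<close>\<close>

lemma poly_even:
  fixes h :: "real poly"
  assumes even: "\<forall>t. poly h (- t) = poly h t" and deg: "degree h = 2 * s"
  shows "poly h t = (\<Sum>j\<le>s. coeff h (2 * j) * t ^ (2 * j))"
proof -
  have "2 * poly h t = poly h t + poly h (- t)" using even by simp
  also have "\<dots> = (\<Sum>i\<le>2 * s. coeff h i * t ^ i + coeff h i * (- t) ^ i)"
    by (simp add: poly_altdef deg sum.distrib)
  also have "\<dots> = (\<Sum>i\<le>2 * s. if even i then 2 * (coeff h i * t ^ i) else 0)"
    by (intro sum.cong refl) (simp add: power_minus_odd)
  also have "\<dots> = (\<Sum>j\<le>s. 2 * (coeff h (2 * j) * t ^ (2 * j)))"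
    by (induction s) simp_all
  finally show ?thesis by (simp flip: sum_distrib_left)
qed

lemma continuous_poly_inner: "continuous_on A (\<lambda>y. poly h (u \<bullet> y))" for u :: "real ^ 'n::finite"
  by (intro continuous_intros)

lemma integrable_poly_inner_mult:
  "f \<in> homogeneous d \<Longrightarrow> integrable sphere_area (\<lambda>y. poly h (u \<bullet> y) * f y)"
  by (intro integrable_sphere_area continuous_on_mult continuous_poly_inner) (rule homogeneous_continuous)

text \<open>Pulling \<open>norm x\<close> out of the inner product cancels the integer power for
  every \<open>j\<close>, also where that power is negative. So the operator is the kernel integral
  on the sphere, extended homogeneously of degree \<open>2 * k\<close>.\<close>

lemma Gamma_hat_eq_integral:
  assumes even: "\<forall>t. poly h (- t) = poly h t" and deg: "degree h = 2 * s"
    and f: "f \<in> homogeneous d" and x: "x \<noteq> 0"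
  shows "Gamma_hat h k f x = norm x ^ (2 * k) * (LINT y|sphere_area. poly h (sgn x \<bullet> y) * f y)"
proof -
  have "Gamma_hat h k f x = (\<Sum>j\<le>s. norm x ^ (2 * k) * (LINT y|sphere_area. coeff h (2 * j) * (sgn x \<bullet> y) ^ (2 * j) * f y))"
    unfolding Gamma_hat_def
  proof (rule sum.cong)
    fix j
    have "x \<bullet> y = norm x * (sgn x \<bullet> y)" for y using x by (simp add: sgn_div_norm)
    then have "(LINT y|sphere_area. (x \<bullet> y) ^ (2 * j) * f y)
       = (LINT y|sphere_area. norm x ^ (2 * j) * ((sgn x \<bullet> y) ^ (2 * j) * f y))"
      by (simp add: power_mult_distrib mult.assoc)
    also have "\<dots> = norm x ^ (2 * j) * (LINT y|sphere_area. (sgn x \<bullet> y) ^ (2 * j) * f y)"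
      by simp
    finally have 1: "(LINT y|sphere_area. (x \<bullet> y) ^ (2 * j) * f y)
       = norm x ^ (2 * j) * (LINT y|sphere_area. (sgn x \<bullet> y) ^ (2 * j) * f y)" .
    have "norm x powi (2 * (int k - int j)) * norm x ^ (2 * j) = norm x powi (2 * (int k - int j) + int (2 * j))"
      using x by (subst power_int_add) (simp_all flip: power_int_of_nat)
    also have "2 * (int k - int j) + int (2 * j) = int (2 * k)" by simp
    finally have 2: "norm x powi (2 * (int k - int j)) * norm x ^ (2 * j) = norm x ^ (2 * k)"
      by (simp only: power_int_of_nat)
    have "coeff h (2 * j) * norm x powi (2 * (int k - int j)) * (norm x ^ (2 * j) * (LINT y|sphere_area. (sgn x \<bullet> y) ^ (2 * j) * f y))
       = (norm x powi (2 * (int k - int j)) * norm x ^ (2 * j)) * (coeff h (2 * j) * (LINT y|sphere_area. (sgn x \<bullet> y) ^ (2 * j) * f y))"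
      by (simp only: mult_ac)
    then show "coeff h (2 * j) * norm x powi (2 * (int k - int j)) * (LINT y|sphere_area. (x \<bullet> y) ^ (2 * j) * f y)
       = norm x ^ (2 * k) * (LINT y|sphere_area. coeff h (2 * j) * (sgn x \<bullet> y) ^ (2 * j) * f y)"
      unfolding 1 2 by (simp add: mult.assoc)
  qed (simp add: deg)
  also have "\<dots> = norm x ^ (2 * k) * (LINT y|sphere_area. (\<Sum>j\<le>s. coeff h (2 * j) * (sgn x \<bullet> y) ^ (2 * j) * f y))"
    by (subst Bochner_Integration.integral_sum)
       (auto simp: sum_distrib_left intro!: integrable_sphere_area continuous_intros homogeneous_continuous[OF f])
  also have "\<dots> = norm x ^ (2 * k) * (LINT y|sphere_area. poly h (sgn x \<bullet> y) * f y)"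
    by (simp only: poly_even[OF even deg] sum_distrib_right)
  finally show ?thesis .
qed

lemma Gamma_hat_0:
  fixes f :: "real ^ 'n::finite \<Rightarrow> real"
  assumes "k \<ge> 1"
  shows "Gamma_hat h k f 0 = 0"
  unfolding Gamma_hat_def
proof (rule sum.neutral, rule ballI)
  fix j
  \<comment> \<open>For \<open>j\<close> different from \<open>k\<close> the integer power of 0 is
    0, also with negative exponent. For \<open>j = k\<close> it is 1, but then the integrand
    vanishes because \<open>k \<ge> 1\<close>.\<close>
  show "coeff h (2 * j) * norm (0 :: real ^ 'n) powi (2 * (int k - int j)) * (LINT y|sphere_area. (0 \<bullet> y) ^ (2 * j) * f y) = 0"
    using assms by (cases "j = k") (simp_all add: power_int_0_left_if zero_power)
qed

text \<open>Only the Gegenbauer summand of the degree of \<open>H\<close> survives. For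
  \<open>j > s\<close> there is none, and extending \<open>lam\<close> by zero records the
  eigenvalue correctly.\<close>

lemma integral_poly_inner_mult_harmonic:
  fixes H :: "real ^ 'n::finite \<Rightarrow> real"
  assumes n: "CARD('n) \<ge> 3" and u: "norm u = 1"
    and h: "h = (\<Sum>j\<le>s. smult (lam (2 * j)) (normalized_gegenbauer TYPE('n) (2 * j)))"
    and lam: "\<forall>j>s. lam (2 * j) = 0" and H: "H \<in> harmonic (2 * j)"
  shows "(LINT y|sphere_area. poly h (u \<bullet> y) * H y) = lam (2 * j) * H u"
proof -
  have "(LINT y|sphere_area. poly h (u \<bullet> y) * H y)
     = (LINT y|sphere_area. (\<Sum>i\<le>s. lam (2 * i) * (poly (normalized_gegenbauer TYPE('n) (2 * i)) (u \<bullet> y) * H y)))"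
    by (simp add: h poly_sum sum_distrib_right mult.assoc)
  also have "\<dots> = (\<Sum>i\<le>s. LINT y|sphere_area. lam (2 * i) * (poly (normalized_gegenbauer TYPE('n) (2 * i)) (u \<bullet> y) * H y))"
    by (intro Bochner_Integration.integral_sum integrable_mult_right
        integrable_poly_inner_mult[OF harmonic_homogeneous[OF H]])
  also have "\<dots> = (\<Sum>i\<le>s. if i = j then lam (2 * i) * H u else 0)"
    by (intro sum.cong refl) (simp add: normalized_gegenbauer_reproducing[OF n H u])
  also have "\<dots> = lam (2 * j) * H u" using lam by simp
  finally show ?thesis .
qed

text \<open>The free coefficients let one statement serve both for a given polynomial
  (\<open>c j = 1\<close>) and for the candidate preimage
  (\<open>c j = 1 / lam (2 * j)\<close>).\<close>

lemma Gamma_hat_decomposition: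
  fixes f :: "real ^ 'n::finite \<Rightarrow> real"
  assumes n: "CARD('n) \<ge> 3" and k: "k \<ge> 1"
    and even: "\<forall>t. poly h (- t) = poly h t" and deg: "degree h = 2 * s"
    and h: "h = (\<Sum>j\<le>s. smult (lam (2 * j)) (normalized_gegenbauer TYPE('n) (2 * j)))"
    and lam: "\<forall>j>s. lam (2 * j) = 0"
    and p: "\<And>j. j \<le> k \<Longrightarrow> p (2 * j) \<in> harmonic (2 * j)"
    and f: "\<And>x. f x = (\<Sum>j\<le>k. c j * (norm x ^ (2 * (k - j)) * p (2 * j) x))"
  shows "Gamma_hat h k f x = (\<Sum>j\<le>k. lam (2 * j) * c j * (norm x ^ (2 * (k - j)) * p (2 * j) x))"
proof -
  have f_eq: "f = (\<lambda>x. \<Sum>j\<le>k. c j * (norm x ^ (2 * (k - j)) * p (2 * j) x))" using f by (rule ext)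
  have f_hom: "f \<in> homogeneous (2 * k)" unfolding f_eq by (rule homogeneous_harmonic_sum[OF p])
  show ?thesis
  proof (cases "x = 0")
    case True
    have "(\<lambda>x. \<Sum>j\<le>k. lam (2 * j) * c j * (norm x ^ (2 * (k - j)) * p (2 * j) x)) \<in> homogeneous (2 * k)"
      by (rule homogeneous_harmonic_sum[OF p])
    from homogeneous_scaleR[OF this, of 0 0] show ?thesis
      using k by (simp add: True Gamma_hat_0 zero_power)
  next
    case False
    then have u: "norm (sgn x) = 1" by (simp add: norm_sgn)
    have "(LINT y|sphere_area. poly h (sgn x \<bullet> y) * f y)
       = (LINT y|sphere_area. (\<Sum>j\<le>k. c j * (poly h (sgn x \<bullet> y) * p (2 * j) y)))"
      by (rule integral_sphere_area_cong) (simp add: f sum_distrib_left mult.left_commute)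
    also have "\<dots> = (\<Sum>j\<le>k. LINT y|sphere_area. c j * (poly h (sgn x \<bullet> y) * p (2 * j) y))"
    proof (rule Bochner_Integration.integral_sum)
      fix j assume "j \<in> {..k}"
      then show "integrable sphere_area (\<lambda>y. c j * (poly h (sgn x \<bullet> y) * p (2 * j) y))"
        by (intro integrable_mult_right integrable_poly_inner_mult[OF harmonic_homogeneous[OF p]]) simp
    qed
    also have "\<dots> = (\<Sum>j\<le>k. c j * (lam (2 * j) * p (2 * j) (sgn x)))"
      using integral_poly_inner_mult_harmonic[OF n u h lam p] by (intro sum.cong refl) simp
    finally have "Gamma_hat h k f x = (\<Sum>j\<le>k. norm x ^ (2 * k) * (c j * (lam (2 * j) * p (2 * j) (sgn x))))"
      by (simp add: Gamma_hat_eq_integral[OF even deg f_hom False] sum_distrib_left)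
    also have "\<dots> = (\<Sum>j\<le>k. lam (2 * j) * c j * (norm x ^ (2 * (k - j)) * p (2 * j) x))"
    proof (rule sum.cong[OF refl])
      fix j assume "j \<in> {..k}"
      then have j: "j \<le> k" by simp
      have "x = norm x *\<^sub>R sgn x" using False by (simp add: sgn_div_norm)
      then have "p (2 * j) x = norm x ^ (2 * j) * p (2 * j) (sgn x)"
        using homogeneous_scaleR[OF harmonic_homogeneous[OF p[OF j]], of "norm x" "sgn x"] by simp
      moreover have "norm x ^ (2 * k) = norm x ^ (2 * (k - j)) * norm x ^ (2 * j)"
      proof -
        have "2 * k = 2 * (k - j) + 2 * j" using j by simp
        then show ?thesis by (simp only: power_add)
      qed
      ultimately show "norm x ^ (2 * k) * (c j * (lam (2 * j) * p (2 * j) (sgn x)))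
          = lam (2 * j) * c j * (norm x ^ (2 * (k - j)) * p (2 * j) x)"
        by (simp only: mult_ac)
    qed
    finally show ?thesis .
  qed
qed

text \<open>The rule is exact for homogeneous polynomials only, and the kernel has terms of several
  degrees. Padding each with a power of the norm, equal to 1 on the sphere, makes them
  homogeneous.\<close>

lemma cubature_poly_inner:
  fixes g :: "real ^ 'n::finite \<Rightarrow> real"
  assumes cub: "cubature_rule (2 * (k + s)) X W"
    and even: "\<forall>t. poly h (- t) = poly h t" and deg: "degree h = 2 * s"
    and g: "g \<in> homogeneous (2 * k)"
  shows "(LINT y|sphere_area. poly h (u \<bullet> y) * g y) = (\<Sum>z\<in>X. W z * (poly h (u \<bullet> z) * g z))"
proof -
  define G where "G y = (\<Sum>j\<le>s. coeff h (2 * j) * (((u \<bullet> y) ^ (2 * j) * norm y ^ (2 * (s - j))) * g y))" for y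
  have G_hom: "G \<in> homogeneous (2 * (k + s))"
    unfolding G_def
  proof (intro homogeneous_sum homogeneous_cmult)
    fix j assume "j \<in> {..s}"
    then show "(\<lambda>y. ((u \<bullet> y) ^ (2 * j) * norm y ^ (2 * (s - j))) * g y) \<in> homogeneous (2 * (k + s))"
      by (intro homogeneous_mult'[OF homogeneous_mult[OF homogeneous_power[OF homogeneous_inner] homogeneous_norm_power] g])
         simp
  qed
  have G_eq: "G y = poly h (u \<bullet> y) * g y" if "norm y = 1" for y
    using that by (simp add: G_def poly_even[OF even deg] sum_distrib_right mult.assoc)
  have "(LINT y|sphere_area. poly h (u \<bullet> y) * g y) = (LINT y|sphere_area. G y)"
    by (rule integral_sphere_area_cong) (simp add: G_eq)
  also have "\<dots> = (\<Sum>z\<in>X. W z * G z)"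
    using cub G_hom by (simp add: cubature_rule_def)
  also have "\<dots> = (\<Sum>z\<in>X. W z * (poly h (u \<bullet> z) * g z))"
    using cub by (intro sum.cong refl) (auto simp: cubature_rule_def G_eq)
  finally show ?thesis .
qed

theorem lemma4p3:
  fixes f F :: "real ^ 'n::finite \<Rightarrow> real"
    and p :: "nat \<Rightarrow> real ^ 'n \<Rightarrow> real"
    and h :: "real poly"
    and lam :: "nat \<Rightarrow> real"
    and X :: "(real ^ 'n) set"
    and W :: "real ^ 'n \<Rightarrow> real"
    and k s :: nat
  assumes n_ge_3: "CARD('n) \<ge> 3"
    and k_pos: "k \<ge> 1"
    and f_homogeneous: "f \<in> homogeneous (2 * k)"
    and h_even: "\<forall>t. poly h (- t) = poly h t"
    and h_degree: "degree h = 2 * s"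
    and h_nonneg: "\<forall>t\<in>{-1..1}. poly h t \<ge> 0"
    and h_expansion: "h = (\<Sum>j\<le>s. smult (lam (2 * j)) (normalized_gegenbauer TYPE('n) (2 * j)))"
    and lam_beyond: "\<forall>j>s. lam (2 * j) = 0"
    and lam_0: "lam 0 = 1"
    and cubature: "cubature_rule (2 * (k + s)) X W"
    and f_decomposition: "harmonic_decomposition k f p"
    and F_def: "F = inv_into (homogeneous (2 * k)) (Gamma_hat h k) f"
  shows "(bij_betw (Gamma_hat h k) (homogeneous (2 * k)) (homogeneous (2 * k) :: (real ^ 'n \<Rightarrow> real) set)
            \<longleftrightarrow> (\<forall>j\<le>k. lam (2 * j) \<noteq> 0)) \<and>
         (bij_betw (Gamma_hat h k) (homogeneous (2 * k)) (homogeneous (2 * k) :: (real ^ 'n \<Rightarrow> real) set)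
            \<longrightarrow> (\<forall>x. F x = (\<Sum>j\<le>k. 1 / lam (2 * j) * norm x ^ (2 * (k - j)) * p (2 * j) x)) \<and>
                (MIN z\<in>X. F z) \<le> (INF x\<in>sphere 0 1. f x))"
proof -
  let ?R = "homogeneous (2 * k) :: (real ^ 'n \<Rightarrow> real) set" and ?G = "Gamma_hat h k"
  note Gamma = Gamma_hat_decomposition[OF n_ge_3 k_pos h_even h_degree h_expansion lam_beyond]
  have decomp: "\<exists>q. (\<forall>j\<le>k. q (2 * j) \<in> harmonic (2 * j)) \<and>
      (\<forall>x. g x = (\<Sum>j\<le>k. 1 * (norm x ^ (2 * (k - j)) * q (2 * j) x)))" if "g \<in> ?R" for g
    using harmonic_decomposition_exists[OF that] by (simp add: harmonic_decomposition_def)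
  have Gamma_inverse: "(\<lambda>x. \<Sum>j\<le>k. 1 / lam (2 * j) * (norm x ^ (2 * (k - j)) * q (2 * j) x)) \<in> ?R
      \<and> ?G (\<lambda>x. \<Sum>j\<le>k. 1 / lam (2 * j) * (norm x ^ (2 * (k - j)) * q (2 * j) x)) = g"
    if lam: "\<forall>j\<le>k. lam (2 * j) \<noteq> 0" and q: "\<And>j. j \<le> k \<Longrightarrow> q (2 * j) \<in> harmonic (2 * j)"
      and g: "\<And>x. g x = (\<Sum>j\<le>k. norm x ^ (2 * (k - j)) * q (2 * j) x)" for q and g :: "real ^ 'n \<Rightarrow> real"
  proof (intro conjI ext)
    fix x
    show "?G (\<lambda>x. \<Sum>j\<le>k. 1 / lam (2 * j) * (norm x ^ (2 * (k - j)) * q (2 * j) x)) x = g x"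
      unfolding g by (rule trans[OF Gamma[OF q refl]]) (use lam in simp_all)
  qed (rule homogeneous_harmonic_sum[OF q])
  have bij_if: "bij_betw ?G ?R ?R" if lam: "\<forall>j\<le>k. lam (2 * j) \<noteq> 0"
    unfolding bij_betw_def
  proof (intro conjI equalityI subsetI inj_onI)
    fix g g' assume "g \<in> ?R" "g' \<in> ?R" and eq: "?G g = ?G g'"
    obtain q where q: "\<And>j. j \<le> k \<Longrightarrow> q (2 * j) \<in> harmonic (2 * j)"
      "\<And>x. g x = (\<Sum>j\<le>k. 1 * (norm x ^ (2 * (k - j)) * q (2 * j) x))"
      using decomp[OF \<open>g \<in> ?R\<close>] by blast
    obtain q' where q': "\<And>j. j \<le> k \<Longrightarrow> q' (2 * j) \<in> harmonic (2 * j)"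
      "\<And>x. g' x = (\<Sum>j\<le>k. 1 * (norm x ^ (2 * (k - j)) * q' (2 * j) x))"
      using decomp[OF \<open>g' \<in> ?R\<close>] by blast
    \<comment> \<open>These are the components of the difference of the two images. Uniqueness makes
      them zero, and dividing by the nonzero \<open>lam\<close> compares the original
      components.\<close>
    define r where "r m x = lam m * q m x + - lam m * q' m x" for m x
    have "r (2 * j) \<in> harmonic (2 * j)" if "j \<le> k" for j
      unfolding r_def by (intro harmonic_add harmonic_cmult q q' that)
    moreover have "(\<Sum>j\<le>k. norm x ^ (2 * (k - j)) * r (2 * j) x) = 0" for x
    proof -
      have "(\<Sum>j\<le>k. norm x ^ (2 * (k - j)) * r (2 * j) x) = ?G g x - ?G g' x"
        by (simp add: Gamma[OF q] Gamma[OF q'] r_def algebra_simps flip: sum_subtractf)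
      then show ?thesis by (simp add: eq)
    qed
    ultimately have "r (2 * j) x = 0" if "j \<le> k" for j x
      by (rule harmonic_decomposition_unique[OF _ _ that])
    then have "q (2 * j) x = q' (2 * j) x" if "j \<le> k" for j x
      using that lam by (simp add: r_def)
    then show "g = g'" by (simp add: fun_eq_iff q(2) q'(2))
  next
    fix g assume "g \<in> ?G ` ?R"
    then obtain g' where g': "g = ?G g'" "g' \<in> ?R" by blast
    obtain q where q: "\<And>j. j \<le> k \<Longrightarrow> q (2 * j) \<in> harmonic (2 * j)"
      "\<And>x. g' x = (\<Sum>j\<le>k. 1 * (norm x ^ (2 * (k - j)) * q (2 * j) x))"
      using decomp[OF \<open>g' \<in> ?R\<close>] by blast
    have "g = (\<lambda>x. \<Sum>j\<le>k. lam (2 * j) * 1 * (norm x ^ (2 * (k - j)) * q (2 * j) x))"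
      unfolding g'(1) by (rule ext) (rule Gamma[OF q])
    then show "g \<in> ?R" using homogeneous_harmonic_sum[OF q(1)] by simp
  next
    fix g assume "g \<in> ?R"
    then obtain q where q: "\<And>j. j \<le> k \<Longrightarrow> q (2 * j) \<in> harmonic (2 * j)"
      "\<And>x. g x = (\<Sum>j\<le>k. norm x ^ (2 * (k - j)) * q (2 * j) x)"
      using harmonic_decomposition_exists[of g k] by (auto simp: harmonic_decomposition_def)
    let ?g' = "\<lambda>x. \<Sum>j\<le>k. 1 / lam (2 * j) * (norm x ^ (2 * (k - j)) * q (2 * j) x)"
    have "?g' \<in> ?R \<and> ?G ?g' = g"
      by (rule Gamma_inverse[OF lam]) (erule q(1), rule q(2))
    then show "g \<in> ?G ` ?R" by (elim conjE) (rule image_eqI[OF sym])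
  qed
  have lam_if: "lam (2 * i) \<noteq> 0" if bij: "bij_betw ?G ?R ?R" and i: "i \<le> k" for i
  proof
    assume 0: "lam (2 * i) = 0"
    define \<alpha> where "\<alpha> = (real CARD('n) - 2) / 2"
    define e :: "real ^ 'n" where "e = axis undefined 1"
    have e: "norm e = 1" by (simp add: e_def)
    \<comment> \<open>If \<open>lam (2 * i)\<close> were 0, the zonal polynomial of degree
      \<open>2 * i\<close> times a power of the norm would lie in the kernel. It is not zero, since
      its value at the pole \<open>e\<close> is the positive Gegenbauer value at 1.\<close>
    define q where "q m = (if m = 2 * i then zonal \<alpha> e m else (\<lambda>_. 0))" for m
    define g where "g x = (\<Sum>j\<le>k. 1 * (norm x ^ (2 * (k - j)) * q (2 * j) x))" for x
    have q: "q (2 * j) \<in> harmonic (2 * j)" for j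
      using harmonic_zonal[OF e \<alpha>_def, of "2 * i"] harmonic_zero by (auto simp: q_def)
    have g: "g \<in> ?R" unfolding g_def by (rule homogeneous_harmonic_sum[OF q])
    have "?G g x = 0" for x
      unfolding Gamma[OF q g_def] by (rule sum.neutral) (auto simp: q_def 0)
    moreover have "?G (\<lambda>_ :: real ^ 'n. 0) x = 0" for x by (simp add: Gamma_hat_def)
    ultimately have "?G g = ?G (\<lambda>_ :: real ^ 'n. 0)" by (simp add: fun_eq_iff)
    then have "g = (\<lambda>_. 0)"
      using bij_betw_imp_inj_on[OF bij] g homogeneous_zero by (simp add: inj_on_eq_iff)
    then have "g e = 0" by simp
    moreover have "g e = (\<Sum>j\<le>k. if j = i then zonal \<alpha> e (2 * i) e else 0)"
      unfolding g_def q_def e by (intro sum.cong refl) simp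
    moreover have "zonal \<alpha> e (2 * i) e = poly (gegenbauer \<alpha> (2 * i)) 1"
      using e by (simp add: zonal_eq_gegenbauer flip: power2_norm_eq_inner)
    moreover have "poly (gegenbauer \<alpha> (2 * i)) 1 > 0"
      using n_ge_3 by (intro gegenbauer_at_1_pos) (simp add: \<alpha>_def)
    ultimately show False using i by simp
  qed
  have main: "(\<forall>x. F x = (\<Sum>j\<le>k. 1 / lam (2 * j) * norm x ^ (2 * (k - j)) * p (2 * j) x)) \<and>
      (MIN z\<in>X. F z) \<le> (INF x\<in>sphere 0 1. f x)" if bij: "bij_betw ?G ?R ?R"
  proof
    have p: "\<And>j. j \<le> k \<Longrightarrow> p (2 * j) \<in> harmonic (2 * j)"
      "\<And>x. f x = (\<Sum>j\<le>k. norm x ^ (2 * (k - j)) * p (2 * j) x)"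
      using f_decomposition by (simp_all add: harmonic_decomposition_def)
    let ?F = "\<lambda>x. \<Sum>j\<le>k. 1 / lam (2 * j) * (norm x ^ (2 * (k - j)) * p (2 * j) x)"
    have F': "?F \<in> ?R \<and> ?G ?F = f"
      by (rule Gamma_inverse) (use lam_if[OF bij] in blast, erule p(1), rule p(2))
    then have F: "F = ?F"
      unfolding F_def by (intro inv_into_f_eq[OF bij_betw_imp_inj_on[OF bij]]) auto
    then show "\<forall>x. F x = (\<Sum>j\<le>k. 1 / lam (2 * j) * norm x ^ (2 * (k - j)) * p (2 * j) x)"
      by (simp add: mult.assoc)
    have F_hom: "F \<in> ?R" and GF: "?G F = f" using F' F by simp_all
    have X: "finite X" "X \<subseteq> sphere 0 1" "\<And>z. z \<in> X \<Longrightarrow> W z > 0"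
      using cubature by (auto simp: cubature_rule_def)
    show "(MIN z\<in>X. F z) \<le> (INF x\<in>sphere 0 1. f x)"
    proof (rule cINF_greatest)
      fix x :: "real ^ 'n" assume "x \<in> sphere 0 1"
      then have x: "norm x = 1" "x \<noteq> 0" "sgn x = x" by (auto simp: sgn_div_norm)
      let ?w = "\<lambda>z. W z * poly h (x \<bullet> z)"
      \<comment> \<open>The constant 1 is padded to degree \<open>2 * k\<close> so that the cubature
        rule applies. The result is that the weights \<open>?w\<close> sum to
        \<open>lam 0 = 1\<close>, which also forces \<open>X\<close> to be nonempty.\<close>
      have "(LINT y|sphere_area. poly h (x \<bullet> y) * norm y ^ (2 * k)) = (LINT y|sphere_area. poly h (x \<bullet> y) * 1)"
        by (rule integral_sphere_area_cong) simp
      also have "\<dots> = 1"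
        using integral_poly_inner_mult_harmonic[OF n_ge_3 x(1) h_expansion lam_beyond, of "\<lambda>_. 1" 0]
        by (simp add: harmonic_const lam_0)
      also have "(LINT y|sphere_area. poly h (x \<bullet> y) * norm y ^ (2 * k)) = (\<Sum>z\<in>X. W z * (poly h (x \<bullet> z) * norm z ^ (2 * k)))"
        by (rule cubature_poly_inner[OF cubature h_even h_degree homogeneous_norm_power])
      also have "\<dots> = (\<Sum>z\<in>X. ?w z)"
        using X(2) by (intro sum.cong refl) auto
      finally have w: "(\<Sum>z\<in>X. ?w z) = 1" .
      have "f x = (LINT y|sphere_area. poly h (x \<bullet> y) * F y)"
        using Gamma_hat_eq_integral[OF h_even h_degree F_hom x(2), of k] by (simp add: GF x)
      also have "\<dots> = (\<Sum>z\<in>X. W z * (poly h (x \<bullet> z) * F z))"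
        by (rule cubature_poly_inner[OF cubature h_even h_degree F_hom])
      also have "\<dots> = (\<Sum>z\<in>X. ?w z * F z)" by (simp add: mult.assoc)
      \<comment> \<open>By Cauchy-Schwarz the arguments of \<open>h\<close> lie in the interval
        where it is nonnegative. So \<open>f x\<close> is a convex combination of values of
        \<open>F\<close> on \<open>X\<close>.\<close>
      also have "\<dots> \<ge> (\<Sum>z\<in>X. ?w z * (MIN z\<in>X. F z))"
      proof (intro sum_mono mult_left_mono)
        fix z assume z: "z \<in> X"
        then show "(MIN z\<in>X. F z) \<le> F z" using X(1) by simp
        have "\<bar>x \<bullet> z\<bar> \<le> 1"
          using Cauchy_Schwarz_ineq2[of x z] x(1) X(2) z by auto
        then show "?w z \<ge> 0"
          using h_nonneg X(3)[OF z] by (intro mult_nonneg_nonneg) (auto simp: abs_le_iff less_imp_le)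
      qed
      finally show "(MIN z\<in>X. F z) \<le> f x" by (simp add: w flip: sum_distrib_right)
    qed simp
  qed
  show ?thesis using bij_if lam_if main by blast
qed

end
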